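(* Let $\epsilon>0$ be the desired accuracy and let $X>0$ be large enough that $X^{-1}=\mathcal{O}(\epsilon)$. Let $\boldsymbol{w}_h^c$ be the trapezoidal reconstruction (defined in the context) from the solution $\check{\boldsymbol{w}}_{f,h}^\gamma$ of the truncated continuous-Fourier system, and $\boldsymbol{u}_h^c=e^p(\langle0|\otimes I)\boldsymbol{w}_h^c$. Let $\tilde\Omega_p=(p^{\gamma,\Diamond},p^{\gamma,\Diamond}+R)$. Then there is a constant $C>0$ independent of the numerical mesh size (and time step) such that, at time $T$, $$\|\boldsymbol{u}_h^c-\boldsymbol{u}\|_{L^2(\tilde\Omega_p)}\le C\left(\epsilon+\frac1\epsilon\triangle\xi^2\Big((p^{\Diamond})^2+\Big\|\int_0^TH_1^A(s)\,ds\Big\|^2\Big)\right)e^{p^{\Diamond}}\big(\|\boldsymbol{u}_0\|+C_T|b|\,\|\boldsymbol{r}_0\|\big).$$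
   Context: Fix $T>0$, $A:[0,T]\to\mathbb{C}^{n\times n}$ and $\boldsymbol{b}=(b_1,\dots,b_n):[0,T]\to\mathbb{C}^n$ continuous, $\boldsymbol{b}\not\equiv\boldsymbol{0}$, $\boldsymbol{u}_0\in\mathbb{C}^n$; $\boldsymbol{u}$ solves $\frac{\mathrm{d}}{\mathrm{d}t}\boldsymbol{u}=A(t)\boldsymbol{u}+\boldsymbol{b}(t)$, $\boldsymbol{u}(0)=\boldsymbol{u}_0$, and $\boldsymbol{u}=\boldsymbol{u}(T)$ is regarded as a constant function of $p$. Set $B=\mathrm{diag}\{b_1,\dots,b_n\}$, $|b|=\max_t\|\boldsymbol{b}(t)\|_{l^\infty}$, $\boldsymbol{r}_0=(1,\dots,1)^\top\in\mathbb{R}^n$, $\gamma=1/(C_T|b|)$ where $C_T=\mathcal{O}(1)$, $C_T\ge T$. Put $H_1^A=(A+A^\dagger)/2$, $H_2^A=(A-A^\dagger)/(2i)$, $$H_1^\gamma=\begin{bmatrix}H_1^A&\frac{\gamma B}{2}\\\frac{\gamma B^\dagger}{2}&O\end{bmatrix},\qquad H_2^\gamma=\begin{bmatrix}H_2^A&\frac{\gamma B}{2i}\\-\frac{\gamma B^\dagger}{2i}&O\end{bmatrix}.$$ With $\sigma(\cdot)$ the set of eigenvalues, $\lambda_{\max}^+(H)=\max\{\sup_{0<t<T}\{|\lambda|:\lambda\in\sigma(H(t)),\lambda>0\},0\}$. Let $p^{\Diamond}=\lambda_{\max}^+(H_1^A)T$, and let $p^{\gamma,\Diamond}=p^{\Diamond}+\mathcal{O}(\gamma|b|T)=\lambda_{\max}^+(H_1^A)T+\mathcal{O}(1)$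 be a recovery threshold, i.e. chosen with $p^{\gamma,\Diamond}\ge\lambda_{\max}^+(H_1^\gamma)T$. $R\ge1$ with $e^R=\mathcal{O}(1)$. $\|\cdot\|$ is the Euclidean norm for vectors and the spectral norm for matrices. Discretization. For a positive integer $N$, $\triangle\xi=2X/N$, $\xi_j=-X+2jX/N$ ($0\le j\le N$), $D_\xi=\mathrm{diag}\{\xi_0,\dots,\xi_N\}$, $\boldsymbol{\xi}_h=\sum_{j=0}^N\frac{1}{\pi(1+\xi_j^2)}|j\rangle$. Then $\check{\boldsymbol{w}}_{f,h}^\gamma$ solves (exactly in time) $$\frac{\mathrm{d}}{\mathrm{d}t}\check{\boldsymbol{w}}_{f,h}^\gamma=i(D_\xi\otimes H_1^\gamma+I\otimes H_2^\gamma)\check{\boldsymbol{w}}_{f,h}^\gamma,\qquad \check{\boldsymbol{w}}_{f,h}^\gamma(0)=\boldsymbol{\xi}_h\otimes\begin{bmatrix}\boldsymbol{u}_0\\C_T|b|\boldsymbol{r}_0\end{bmatrix},$$ and with $\check{\boldsymbol{w}}_j=(\langle j|\otimes I_{2n})\check{\boldsymbol{w}}_{f,h}^\gamma$, $$\boldsymbol{w}_h^c(t,p)=\triangle\xi\sum_{j=1}^{N-1}\check{\boldsymbol{w}}_je^{-i\xi_jp}+\frac{\triangle\xi}{2}\big(\check{\boldsymbol{w}}_Ne^{-i\xi_Np}+\check{\boldsymbol{w}}_0e^{-i\xi_0p}\big)\in\mathbb{C}^{2n}.$$ $\langle0|\otimes I$ selects the first $n$ components of $\mathbb{C}^{2n}$.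 *)

theory Defs
  imports "HOL-Analysis.Analysis"
begin

definition cadjoint :: "complex^'m^'n \<Rightarrow> complex^'n^'m" where
  "cadjoint M = (\<chi> i j. cnj (M $ j $ i))"

definition cscale :: "complex \<Rightarrow> complex^'m^'n \<Rightarrow> complex^'m^'n" where
  "cscale c M = (\<chi> i j. c * M $ i $ j)"

definition diag_mat :: "complex^'n \<Rightarrow> complex^'n^'n" where
  "diag_mat v = (\<chi> i j. if i = j then v $ i else 0)"

text \<open>\<open>\<complex>\<^bsup>2n\<^esup>\<close> is indexed by the sum type \<open>'n + 'n\<close>: \<open>Inl\<close> indexes the first
  \<open>n\<close> components and \<open>Inr\<close> the last \<open>n\<close>.\<close>

definition block_mat ::
  "complex^'n^'n \<Rightarrow> complex^'n^'n \<Rightarrow> complex^'n^'n \<Rightarrow> complex^'n^'n \<Rightarrow> complex^('n + 'n)^('n + 'n)"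
  where "block_mat P Q R S = (\<chi> i j.
    case i of
      Inl k \<Rightarrow> (case j of Inl l \<Rightarrow> P $ k $ l | Inr l \<Rightarrow> Q $ k $ l)
    | Inr k \<Rightarrow> (case j of Inl l \<Rightarrow> R $ k $ l | Inr l \<Rightarrow> S $ k $ l))"

definition stack_vec :: "complex^'n \<Rightarrow> complex^'n \<Rightarrow> complex^('n + 'n)" where
  "stack_vec x y = (\<chi> i. case i of Inl k \<Rightarrow> x $ k | Inr k \<Rightarrow> y $ k)"

definition first_block :: "complex^('n + 'n) \<Rightarrow> complex^'n" where
  "first_block z = (\<chi> k. z $ Inl k)"

text \<open>The norm of the type \<^typ>\<open>complex^'n^'n\<close> is the Frobenius norm, so the spectral norm is
  written as an operator norm (with respect to the Euclidean norm of vectors).\<close>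

definition spectral_norm :: "complex^'n^'m \<Rightarrow> real" where
  "spectral_norm M = onorm (\<lambda>v. M *v v)"

definition eigenvalues :: "complex^'n^'n \<Rightarrow> complex set" where
  "eigenvalues M = {\<mu>. \<exists>v. v \<noteq> 0 \<and> M *v v = \<mu> *s v}"

text \<open>For the Hermitian matrices concerned the set below is bounded, and adjoining \<open>0\<close> inside
  the supremum is the outer maximum with \<open>0\<close>; it also covers the case that there is no
  positive eigenvalue, since \<^const>\<open>Sup\<close> of the empty set of reals is unspecified.\<close>

definition lambda_max_plus :: "real \<Rightarrow> (real \<Rightarrow> complex^'n^'n) \<Rightarrow> real" where
  "lambda_max_plus T H =
     Sup (insert 0 {cmod \<mu> | \<mu> t. 0 < t \<and> t < T \<and> \<mu> \<in> eigenvalues (H t) \<and> \<mu> \<in> \<real> \<and> Re \<mu> > 0})"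

definition linf_norm :: "complex^'n \<Rightarrow> real" where
  "linf_norm v = Max (range (\<lambda>i. cmod (v $ i)))"

definition sup_norm_on :: "real \<Rightarrow> (real \<Rightarrow> complex^'n) \<Rightarrow> real" where
  "sup_norm_on T b = (SUP t\<in>{0..T}. linf_norm (b t))"

definition H1A :: "complex^'n^'n \<Rightarrow> complex^'n^'n" where
  "H1A A = cscale (1 / 2) (A + cadjoint A)"

definition H2A :: "complex^'n^'n \<Rightarrow> complex^'n^'n" where
  "H2A A = cscale (1 / (2 * \<i>)) (A - cadjoint A)"

definition H1gam :: "real \<Rightarrow> complex^'n^'n \<Rightarrow> complex^'n \<Rightarrow> complex^('n + 'n)^('n + 'n)" where
  "H1gam \<gamma> A b = block_mat
     (H1A A)                                                  (cscale (of_real \<gamma> / 2) (diag_mat b))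
     (cscale (of_real \<gamma> / 2) (cadjoint (diag_mat b)))         0"

definition H2gam :: "real \<Rightarrow> complex^'n^'n \<Rightarrow> complex^'n \<Rightarrow> complex^('n + 'n)^('n + 'n)" where
  "H2gam \<gamma> A b = block_mat
     (H2A A)                                                  (cscale (of_real \<gamma> / (2 * \<i>)) (diag_mat b))
     (cscale (- (of_real \<gamma> / (2 * \<i>))) (cadjoint (diag_mat b)))   0"

definition r0 :: "complex^'n" where
  "r0 = (\<chi> i. 1)"

definition solves_linear_ode ::
  "real \<Rightarrow> (real \<Rightarrow> complex^'n^'n) \<Rightarrow> (real \<Rightarrow> complex^'n) \<Rightarrow> complex^'n \<Rightarrow> (real \<Rightarrow> complex^'n) \<Rightarrow> bool"
  where "solves_linear_ode T A b u0 u \<longleftrightarrow>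
    u 0 = u0 \<and>
    (\<forall>t\<in>{0..T}. (u has_vector_derivative (A t *v u t + b t)) (at t within {0..T}))"

text \<open>A vector in \<open>\<complex>\<^bsup>N+1\<^esup> \<otimes> \<complex>\<^bsup>m\<^esup>\<close> is a family \<open>v :: nat \<Rightarrow> complex^'m\<close> of blocks, of which only
  those with index at most \<open>N\<close> matter; \<open>v j\<close> is \<open>(\<langle>j| \<otimes> I) v\<close>.  An operator on this space is a
  family \<open>L\<close> of matrix blocks, \<open>L j k\<close> mapping the \<open>k\<close>-th block into the \<open>j\<close>-th one.\<close>

definition kron_mat :: "(nat \<Rightarrow> nat \<Rightarrow> complex) \<Rightarrow> complex^'m^'m \<Rightarrow> nat \<Rightarrow> nat \<Rightarrow> complex^'m^'m" where
  "kron_mat M H j k = cscale (M j k) H"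

definition kron_vec :: "(nat \<Rightarrow> complex) \<Rightarrow> complex^'m \<Rightarrow> nat \<Rightarrow> complex^'m" where
  "kron_vec a v j = a j *s v"

definition block_apply ::
  "nat \<Rightarrow> (nat \<Rightarrow> nat \<Rightarrow> complex^'m^'m) \<Rightarrow> (nat \<Rightarrow> complex^'m) \<Rightarrow> nat \<Rightarrow> complex^'m" where
  "block_apply N L v j = (\<Sum>k\<le>N. L j k *v v k)"

definition mesh :: "real \<Rightarrow> nat \<Rightarrow> real" where
  "mesh X N = 2 * X / real N"

definition node :: "real \<Rightarrow> nat \<Rightarrow> nat \<Rightarrow> real" where
  "node X N j = - X + 2 * real j * X / real N"

definition D_xi :: "real \<Rightarrow> nat \<Rightarrow> nat \<Rightarrow> nat \<Rightarrow> complex" where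
  "D_xi X N j k = (if j = k then of_real (node X N j) else 0)"

definition Id_xi :: "nat \<Rightarrow> nat \<Rightarrow> complex" where
  "Id_xi j k = (if j = k then 1 else 0)"

definition xi_vec :: "real \<Rightarrow> nat \<Rightarrow> nat \<Rightarrow> complex" where
  "xi_vec X N j = of_real (1 / (pi * (1 + (node X N j)\<^sup>2)))"

definition solves_fourier_system ::
  "real \<Rightarrow> real \<Rightarrow> nat \<Rightarrow> (real \<Rightarrow> complex^'m^'m) \<Rightarrow> (real \<Rightarrow> complex^'m^'m) \<Rightarrow> complex^'m
    \<Rightarrow> (real \<Rightarrow> nat \<Rightarrow> complex^'m) \<Rightarrow> bool"
  where "solves_fourier_system T X N H1 H2 v0 w \<longleftrightarrow>
    (\<forall>j\<le>N. w 0 j = kron_vec (xi_vec X N) v0 j) \<and>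
    (\<forall>t\<in>{0..T}. \<forall>j\<le>N.
       ((\<lambda>s. w s j) has_vector_derivative
          block_apply N
            (\<lambda>k l. cscale \<i> (kron_mat (D_xi X N) (H1 t) k l + kron_mat Id_xi (H2 t) k l))
            (w t) j)
         (at t within {0..T}))"

definition trapezoid_reconstruction ::
  "real \<Rightarrow> nat \<Rightarrow> (nat \<Rightarrow> complex^'m) \<Rightarrow> real \<Rightarrow> complex^'m" where
  "trapezoid_reconstruction X N v p =
     mesh X N *\<^sub>R (\<Sum>j = 1..N - 1. exp (- \<i> * of_real (node X N j * p)) *s v j) +
     (mesh X N / 2) *\<^sub>R
       (exp (- \<i> * of_real (node X N N * p)) *s v N + exp (- \<i> * of_real (node X N 0 * p)) *s v 0)"

definition recovered_solution ::
  "real \<Rightarrow> nat \<Rightarrow> (nat \<Rightarrow> complex^('n + 'n)) \<Rightarrow> real \<Rightarrow> complex^'n" where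
  "recovered_solution X N v p = exp p *\<^sub>R first_block (trapezoid_reconstruction X N v p)"

definition L2_norm_on :: "real set \<Rightarrow> (real \<Rightarrow> complex^'n) \<Rightarrow> real" where
  "L2_norm_on S f = sqrt (set_lebesgue_integral lborel S (\<lambda>p. (norm (f p))\<^sup>2))"

end

theory Submission
  imports Defs "HOL-Complex_Analysis.Cauchy_Integral_Formula"
begin

text \<open>The trapezoidal reconstruction is a finite sum of modes \<open>e\<^sup>z\<^sup>p y(t)\<close> with \<open>z = - \<i> \<xi>\<^sub>j\<close>, each of which
  solves the transport equation \<open>\<partial>\<^sub>t w = - H\<^sub>1 \<partial>\<^sub>p w + \<i> H\<^sub>2 w\<close> exactly; so does the mode \<open>z = - 1\<close> given by
  \<open>e\<^sup>-\<^sup>p\<close> times the augmented exact solution. Their difference has finite propagation speed: no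
  energy enters from the left of \<open>p = a + \<Lambda> t\<close> when \<open>\<Lambda>\<close> bounds the positive eigenvalues of \<open>H\<^sub>1\<close>. The error
  on the recovery interval at time \<open>T\<close> is therefore bounded by the error at time \<open>0\<close> on a bounded
  part of \<open>p \<ge> 0\<close>, where it is the scalar quadrature error for
  \<open>e\<^sup>-\<^sup>p = \<integral> e\<^sup>-\<^sup>\<i>\<^sup>\<xi>\<^sup>p / (\<pi> (1 + \<xi>\<^sup>2)) d\<xi>\<close>. The truncation costs \<open>O(1 / X)\<close> by Cauchy's theorem and
  the trapezoidal rule costs \<open>O(\<triangle>\<xi>)\<close> because the integrand has bounded variation. First order
  suffices: by AM-GM, \<open>\<triangle>\<xi>\<close> is at most a constant times \<open>\<epsilon> + \<triangle>\<xi>\<^sup>2 F / \<epsilon>\<close> whenever the coefficient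
  \<open>F = (p\<^sup>\<diamond>)\<^sup>2 + \<parallel>\<integral> H\<^sub>1\<^sup>A\<parallel>\<^sup>2\<close> is positive.\<close>

section \<open>Hermitian matrices and the largest eigenvalue\<close>

lemma scaleR_eq_scale_complex: "r *\<^sub>R x = complex_of_real r *s x"
  by (auto simp: vec_eq_iff scaleR_conv_of_real[where 'a = complex])

lemma norm_scale_complex: "norm (c *s (x :: complex^'n)) = cmod c * norm x"
  by (simp add: norm_vec_def norm_mult L2_set_right_distrib)

lemma bounded_bilinear_scale_complex:
  "bounded_bilinear ((*s) :: complex \<Rightarrow> complex^'n \<Rightarrow> complex^'n)"
  unfolding bilinear_conv_bounded_bilinear[symmetric] bilinear_def
  by (auto intro!: linearI simp: vec_eq_iff algebra_simps)

lemma bounded_bilinear_matrix_vector_complex: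
  "bounded_bilinear ((*v) :: complex^'n^'m \<Rightarrow> complex^'n \<Rightarrow> complex^'m)"
  unfolding bilinear_conv_bounded_bilinear[symmetric] bilinear_def
  by (auto intro!: linearI
      simp: vec_eq_iff matrix_vector_mult_def algebra_simps sum.distrib scaleR_sum_right)

lemmas continuous_on_scale_complex =
  bounded_bilinear.continuous_on[OF bounded_bilinear_scale_complex]
lemmas continuous_on_matrix_vector_complex =
  bounded_bilinear.continuous_on[OF bounded_bilinear_matrix_vector_complex]

lemma inner_complex_vec_eq_Re: "inner (x::complex^'n) y = Re (\<Sum>i\<in>UNIV. cnj (x $ i) * y $ i)"
  by (simp add: inner_vec_def inner_complex_def)

lemma inner_matrix_vector_cadjoint:
  fixes M :: "complex^'n^'m"
  shows "inner x (M *v y) = inner (cadjoint M *v x) y"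
proof -
  have "(\<Sum>i\<in>UNIV. cnj (x $ i) * (M *v y) $ i)
      = (\<Sum>i\<in>UNIV. \<Sum>j\<in>UNIV. cnj (x $ i) * M $ i $ j * y $ j)"
    by (simp add: matrix_vector_mult_def sum_distrib_left mult.assoc)
  also have "\<dots> = (\<Sum>j\<in>UNIV. \<Sum>i\<in>UNIV. cnj (x $ i) * M $ i $ j * y $ j)"
    by (rule sum.swap)
  also have "\<dots> = (\<Sum>j\<in>UNIV. cnj ((cadjoint M *v x) $ j) * y $ j)"
    by (simp add: matrix_vector_mult_def cadjoint_def sum_distrib_right sum_distrib_left mult_ac)
  finally show ?thesis by (simp only: inner_complex_vec_eq_Re)
qed

lemma inner_scale_complex: "inner (c *s x) (y :: complex^'n) = inner x (cnj c *s y)"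
  unfolding inner_complex_vec_eq_Re by (simp only: vector_smult_component complex_cnj_mult mult_ac)

lemma matrix_vector_scale: "M *v (c *s x) = c *s (M *v (x :: complex^'n))"
  by (simp add: vec_eq_iff matrix_vector_mult_def sum_distrib_left mult_ac)

text \<open>Multiplication by \<open>\<i>\<close> commutes with \<open>M\<close> and is skew for the
  real inner product, so the quantity equals its own negative. This removes \<open>H2\<close> from
  the energy balance.\<close>

lemma inner_i_hermitian:
  fixes M :: "complex^'n^'n"
  assumes "cadjoint M = M"
  shows "inner x (\<i> *s (M *v x)) = 0"
proof -
  have "inner x (\<i> *s (M *v x)) = inner x (M *v (\<i> *s x))"
    by (simp add: matrix_vector_scale)
  also have "\<dots> = inner (M *v x) (\<i> *s x)"
    by (simp add: inner_matrix_vector_cadjoint assms)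
  also have "\<dots> = inner (\<i> *s x) (M *v x)" by (rule inner_commute)
  also have "\<dots> = inner x (cnj \<i> *s (M *v x))" by (rule inner_scale_complex)
  also have "\<dots> = - inner x (\<i> *s (M *v x))"
    by (simp add: vector_smult_lneg)
  finally show ?thesis by simp
qed

text \<open>Moving from \<open>v\<close> along \<open>S v\<close> changes the form to first order by
  \<open>2 * r * \<alpha>\<close>, so a nonzero \<open>S v\<close> would make it negative for a
  small negative \<open>r\<close>.\<close>

lemma psd_form_zero_imp_kernel:
  fixes S :: "'a::real_inner \<Rightarrow> 'a"
  assumes lin: "linear S" and sym: "\<And>x y. inner x (S y) = inner (S x) y"
    and psd: "\<And>x. 0 \<le> inner x (S x)" and zero: "inner v (S v) = 0"
  shows "S v = 0"
proof (rule ccontr)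
  assume "S v \<noteq> 0"
  define \<alpha> where "\<alpha> = inner (S v) (S v)"
  define \<beta> where "\<beta> = inner (S v) (S (S v))"
  have "\<alpha> > 0" using \<open>S v \<noteq> 0\<close> by (simp add: \<alpha>_def)
  have "\<beta> \<ge> 0" using psd by (simp add: \<beta>_def)
  have quad: "0 \<le> 2 * r * \<alpha> + r\<^sup>2 * \<beta>" for r
    using psd[of "v + r *\<^sub>R S v"] zero sym[of v "S v"]
    by (simp add: linear_add[OF lin] linear_scale[OF lin] inner_simps \<alpha>_def \<beta>_def power2_eq_square
        algebra_simps)
  \<comment> \<open>This size of \<open>r\<close> keeps
    \<open>2 * \<alpha> + r * \<beta> \<ge> \<alpha> > 0\<close> while \<open>r < 0\<close>; the
    summand 1 in the denominator covers \<open>\<beta> = 0\<close>.\<close>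
  define r where "r = - \<alpha> / (\<beta> + 1)"
  have "r < 0" "- \<alpha> \<le> r * \<beta>"
    using \<open>\<alpha> > 0\<close> \<open>\<beta> \<ge> 0\<close> by (auto simp: r_def divide_simps)
  moreover have "0 \<le> r * (2 * \<alpha> + r * \<beta>)"
    using quad[of r] by (simp add: power2_eq_square algebra_simps)
  ultimately show False using \<open>\<alpha> > 0\<close> by (simp add: zero_le_mult_iff)
qed

text \<open>The form attains its maximum \<open>l\<close> over the compact unit sphere at some
  \<open>v\<close>. Then \<open>l I - M\<close> is positive semidefinite and its form vanishes at
  \<open>v\<close>, so \<open>v\<close> lies in its kernel.\<close>

lemma hermitian_max_rayleigh_eigenvalue:
  fixes M :: "complex^'n^'n"
  assumes herm: "cadjoint M = M"
  obtains l where "complex_of_real l \<in> eigenvalues M"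
    "\<And>x. inner x (M *v x) \<le> l * inner x x"
proof -
  let ?f = "\<lambda>x. inner x (M *v x)"
  have "(axis undefined 1 :: complex^'n) \<in> sphere 0 1" by (simp add: norm_eq_1 inner_axis)
  then have "sphere (0::complex^'n) 1 \<noteq> {}" by blast
  moreover have "continuous_on (sphere 0 1) ?f"
    by (intro continuous_intros continuous_on_matrix_vector_complex)
  ultimately obtain v where v: "v \<in> sphere 0 1" "\<And>x. x \<in> sphere 0 1 \<Longrightarrow> ?f x \<le> ?f v"
    using continuous_attains_sup[of "sphere 0 1" ?f] by auto
  define l where "l = ?f v"
  have vv: "inner v v = 1" using v(1) by (simp add: dot_square_norm)
  have le: "?f x \<le> l * inner x x" for x
  proof (cases "x = 0")
    case False
    have "?f ((1 / norm x) *\<^sub>R x) \<le> l"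
      unfolding l_def using False by (intro v(2)) simp
    then have "?f x / (norm x)\<^sup>2 \<le> l"
      by (simp add: bounded_bilinear.scaleR_right[OF bounded_bilinear_matrix_vector_complex]
          power2_eq_square)
    then show ?thesis using False by (simp add: divide_le_eq dot_square_norm)
  qed (simp add: matrix_vector_mult_0_right)
  let ?S = "\<lambda>x. l *\<^sub>R x - M *v x"
  have "?S v = 0"
  proof (rule psd_form_zero_imp_kernel[where S = ?S])
    show "linear ?S"
      by (intro linearI) (simp_all add: matrix_vector_right_distrib algebra_simps
          bounded_bilinear.scaleR_right[OF bounded_bilinear_matrix_vector_complex])
    show "inner x (?S y) = inner (?S x) y" for x y
      using inner_matrix_vector_cadjoint[of x M y] by (simp add: herm inner_diff_left inner_diff_right)
    show "0 \<le> inner x (?S x)" for x using le[of x] by (simp add: inner_diff_right)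
    show "inner v (?S v) = 0" by (simp add: inner_diff_right vv l_def)
  qed
  then have "M *v v = complex_of_real l *s v"
    by (simp add: scaleR_eq_scale_complex)
  moreover have "v \<noteq> 0" using vv by auto
  ultimately have "complex_of_real l \<in> eigenvalues M" by (auto simp: eigenvalues_def)
  then show ?thesis using le that by blast
qed

text \<open>Continuity on the compact interval bounds all eigenvalues, so the supremum is a genuine
  upper bound. The maximal Rayleigh quotient at \<open>t\<close> is an eigenvalue: if positive it
  belongs to the set, otherwise the adjoined 0 dominates it.\<close>

lemma rayleigh_le_lambda_max_plus:
  fixes H :: "real \<Rightarrow> complex^'n^'n"
  assumes cont: "continuous_on {0..T} H" and herm: "\<And>t. cadjoint (H t) = H t"
    and t: "0 < t" "t < T"
  shows "inner x (H t *v x) \<le> lambda_max_plus T H * inner x x"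
    and "0 \<le> lambda_max_plus T H"
proof -
  let ?S = "insert 0 {cmod \<mu> | \<mu> t. 0 < t \<and> t < T \<and> \<mu> \<in> eigenvalues (H t) \<and> \<mu> \<in> \<real> \<and> Re \<mu> > 0}"
  obtain M where M: "\<And>t. t \<in> {0..T} \<Longrightarrow> norm (H t) \<le> M"
    using compact_imp_bounded[OF compact_continuous_image[OF cont compact_Icc]]
    unfolding bounded_iff by (meson imageI)
  obtain k where k: "k > 0" "\<And>(P::complex^'n^'n) v. norm (P *v v) \<le> norm P * norm v * k"
    using bounded_bilinear.pos_bounded[OF bounded_bilinear_matrix_vector_complex] by blast
  have "bdd_above ?S"
  proof (rule bdd_aboveI)
    fix y assume "y \<in> ?S"
    then consider "y = 0" | \<mu> s v where "y = cmod \<mu>" "0 < s" "s < T" "v \<noteq> 0" "H s *v v = \<mu> *s v"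
      by (auto simp: eigenvalues_def)
    then show "y \<le> max 0 (M * k)"
    proof cases
      case 2
      have "cmod \<mu> * norm v \<le> norm (H s) * norm v * k"
        using k(2)[of "H s" v] 2 by (simp add: norm_scale_complex)
      then have "cmod \<mu> \<le> norm (H s) * k" using 2 by (simp add: field_simps)
      also have "\<dots> \<le> M * k" using M[of s] 2 k(1) by simp
      finally show ?thesis using 2 by simp
    qed simp
  qed
  then have Sup: "y \<le> lambda_max_plus T H" if "y \<in> ?S" for y
    unfolding lambda_max_plus_def using that by (rule cSup_upper[rotated])
  show nonneg: "0 \<le> lambda_max_plus T H" by (rule Sup) simp
  obtain l where l: "complex_of_real l \<in> eigenvalues (H t)"
    "\<And>x. inner x (H t *v x) \<le> l * inner x x"
    using hermitian_max_rayleigh_eigenvalue[OF herm] by blast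
  have "l \<le> lambda_max_plus T H"
  proof (cases "l > 0")
    case True
    have "cmod (of_real l) \<le> lambda_max_plus T H"
      by (rule Sup) (use True l(1) t in force)
    then show ?thesis using True by simp
  qed (use nonneg in simp)
  then show "inner x (H t *v x) \<le> lambda_max_plus T H * inner x x"
    using l(2)[of x] mult_right_mono[OF _ inner_ge_zero, of l "lambda_max_plus T H" x] by linarith
qed

section \<open>The augmented block matrices\<close>

lemma sum_UNIV_sum_type:
  fixes f :: "'a::finite + 'b::finite \<Rightarrow> 'c::comm_monoid_add"
  shows "sum f UNIV = (\<Sum>k\<in>UNIV. f (Inl k)) + (\<Sum>k\<in>UNIV. f (Inr k))"
  unfolding UNIV_Plus_UNIV[symmetric] by (subst sum.Plus) (simp_all del: UNIV_Plus_UNIV)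

lemma cscale_matrix_vector: "cscale c M *v x = c *s (M *v x)"
  by (simp add: vec_eq_iff matrix_vector_mult_def cscale_def sum_distrib_left mult_ac)

lemma block_mat_stack_vec:
  "block_mat P Q R S *v stack_vec x y = stack_vec (P *v x + Q *v y) (R *v x + S *v y)"
  by (auto simp: vec_eq_iff matrix_vector_mult_def block_mat_def stack_vec_def sum_UNIV_sum_type
      split: sum.splits)

lemma stack_vec_add: "stack_vec x y + stack_vec x' y' = stack_vec (x + x') (y + y')"
  by (simp add: vec_eq_iff stack_vec_def split: sum.split)

lemma scale_stack_vec: "c *s stack_vec x y = stack_vec (c *s x) (c *s y)"
  by (simp add: vec_eq_iff stack_vec_def split: sum.split)

lemma first_block_stack_vec: "first_block (stack_vec x y) = x"
  by (simp add: vec_eq_iff first_block_def stack_vec_def)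

lemma norm_stack_vec_sq: "(norm (stack_vec x y))\<^sup>2 = (norm x)\<^sup>2 + (norm y)\<^sup>2"
  by (simp add: power2_norm_eq_inner inner_vec_def stack_vec_def sum_UNIV_sum_type)

lemma norm_stack_vec_le: "norm (stack_vec x y) \<le> norm x + norm y"
proof (rule power2_le_imp_le)
  show "(norm (stack_vec x y))\<^sup>2 \<le> (norm x + norm y)\<^sup>2"
    by (simp add: norm_stack_vec_sq power2_sum)
qed simp

lemma stack_vec_first_block: "z = stack_vec (first_block z) (\<chi> k. z $ Inr k)"
  by (simp add: vec_eq_iff stack_vec_def first_block_def split: sum.split)

lemma norm_first_block_le: "norm (first_block z) \<le> norm z"
proof (rule power2_le_imp_le)
  show "(norm (first_block z))\<^sup>2 \<le> (norm z)\<^sup>2"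
    using norm_stack_vec_sq[of "first_block z" "\<chi> k. z $ Inr k"] stack_vec_first_block[of z] by simp
qed simp

lemma bounded_linear_first_block: "bounded_linear first_block"
  unfolding linear_conv_bounded_linear[symmetric]
  by (intro linearI) (simp_all add: vec_eq_iff first_block_def)

lemma cadjoint_H1gam: "cadjoint (H1gam \<gamma> A b) = H1gam \<gamma> A b"
  by (auto simp: vec_eq_iff cadjoint_def H1gam_def block_mat_def H1A_def cscale_def diag_mat_def
      algebra_simps split: sum.split)

lemma cadjoint_H2gam: "cadjoint (H2gam \<gamma> A b) = H2gam \<gamma> A b"
  by (auto simp: vec_eq_iff cadjoint_def H2gam_def block_mat_def H2A_def cscale_def diag_mat_def
      field_simps split: sum.split)

lemma diag_mat_vec: "(diag_mat b *v x) = (\<chi> i. b $ i * x $ i)"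
  by (simp add: vec_eq_iff matrix_vector_mult_def diag_mat_def if_distrib if_distribR cong: if_cong)

text \<open>The two halves of \<gamma> B add up and the two halves of its adjoint cancel, which
  leaves the block rows \<open>(A, \<gamma> B)\<close> and \<open>(0, 0)\<close>. The lower block of
  the augmented system therefore stays constant in time.\<close>

lemma H1gam_plus_i_H2gam:
  "H1gam \<gamma> A b *v stack_vec x y + \<i> *s (H2gam \<gamma> A b *v stack_vec x y)
    = stack_vec (A *v x + of_real \<gamma> *s (diag_mat b *v y)) 0"
proof -
  have "H1A A *v x + \<i> *s (H2A A *v x) = A *v x"
    by (simp add: H1A_def H2A_def cscale_matrix_vector matrix_vector_mult_add_rdistrib
        matrix_vector_mult_diff_rdistrib vec_eq_iff field_simps)
  then show ?thesis
    unfolding H1gam_def H2gam_def block_mat_stack_vec scale_stack_vec stack_vec_add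
    by (intro arg_cong2[where f = stack_vec])
       (auto simp: cscale_matrix_vector vec_eq_iff field_simps)
qed

lemma continuous_on_if_const:
  "(P \<Longrightarrow> continuous_on S f) \<Longrightarrow> (\<not> P \<Longrightarrow> continuous_on S g)
    \<Longrightarrow> continuous_on S (\<lambda>x. if P then f x else g x)"
  by (cases P) auto

text \<open>The coupling is a function \<open>g\<close> because the compactness argument for the
  lower form bound runs jointly over time and \<gamma>.\<close>

lemma continuous_on_H1gam:
  fixes A :: "'a::topological_space \<Rightarrow> complex^'n^'n"
  assumes "continuous_on S g" "continuous_on S A" "continuous_on S b"
  shows "continuous_on S (\<lambda>t. H1gam (g t) (A t) (b t))"
  unfolding H1gam_def block_mat_def
  apply (intro continuous_on_vec_lambda)
  subgoal for i j
    using assms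
    by (cases i; cases j)
      (auto simp: H1A_def cscale_def diag_mat_def cadjoint_def intro!: continuous_on_if_const continuous_intros)
  done

lemma continuous_on_H2gam:
  fixes A :: "'a::topological_space \<Rightarrow> complex^'n^'n"
  assumes "continuous_on S g" "continuous_on S A" "continuous_on S b"
  shows "continuous_on S (\<lambda>t. H2gam (g t) (A t) (b t))"
  unfolding H2gam_def block_mat_def
  apply (intro continuous_on_vec_lambda)
  subgoal for i j
    using assms
    by (cases i; cases j)
      (auto simp: H2A_def cscale_def diag_mat_def cadjoint_def intro!: continuous_on_if_const continuous_intros)
  done

section \<open>Energy estimate for the transport equation\<close>

text \<open>Modes \<open>e\<^sup>z\<^sup>p y(t)\<close> solving \<open>\<partial>\<^sub>t e = - H\<^sub>1 \<partial>\<^sub>p e + \<i> H\<^sub>2 e\<close> are followed on an interval whose left end moves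
  right with speed \<open>\<Lambda>\<close> and whose right end moves left with speed \<open>\<mu>\<close>, so that the energy only
  flows out.\<close>

lemma energy_estimate:
  fixes H1 H2 :: "real \<Rightarrow> complex^'m^'m" and y :: "'i \<Rightarrow> real \<Rightarrow> complex^'m"
    and z c :: "'i \<Rightarrow> complex" and I :: "'i set"
  defines "e \<equiv> \<lambda>t p. \<Sum>k\<in>I. (c k * exp (z k * of_real p)) *s y k t"
  assumes T: "0 \<le> T" and fin: "finite I"
    and cont: "continuous_on {0..T} H1" "continuous_on {0..T} H2"
    and herm: "\<And>t. cadjoint (H1 t) = H1 t" "\<And>t. cadjoint (H2 t) = H2 t"
    and ode: "\<And>k t. k \<in> I \<Longrightarrow> t \<in> {0..T} \<Longrightarrow> (y k has_vector_derivative
        (- z k *s (H1 t *v y k t) + \<i> *s (H2 t *v y k t))) (at t within {0..T})"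
    and upper: "\<And>t v. t \<in> {0<..<T} \<Longrightarrow> inner v (H1 t *v v) \<le> \<Lambda> * inner v v"
    and lower: "\<And>t v. t \<in> {0<..<T} \<Longrightarrow> - (\<mu> * inner v v) \<le> inner v (H1 t *v v)"
    and ab: "0 \<le> \<Lambda>" "0 \<le> \<mu>" "a + \<Lambda> * T \<le> b - \<mu> * T"
  shows "integral {a + \<Lambda> * T..b - \<mu> * T} (\<lambda>p. (norm (e T p))\<^sup>2)
    \<le> integral {a..b} (\<lambda>p. (norm (e 0 p))\<^sup>2)"
proof -
  \<comment> \<open>\<open>ep\<close> is the p-derivative of \<open>e\<close>, and \<open>et\<close>
    is its time derivative as given by the transport equation. \<open>P t\<close> maps [0, 1]
    affinely onto the moving interval of length \<open>l t\<close>, so that the integrals to be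
    differentiated have fixed limits.\<close>
  define ep where "ep = (\<lambda>t p. \<Sum>k\<in>I. (c k * exp (z k * of_real p)) *s (z k *s y k t))"
  define l where "l = (\<lambda>t. b - a - (\<Lambda> + \<mu>) * t)"
  define P where "P = (\<lambda>t s. a + \<Lambda> * t + s * l t)"
  define q where "q = (\<lambda>t p. inner (e t p) (e t p))"
  define et where "et = (\<lambda>t p. - (H1 t *v ep t p) + \<i> *s (H2 t *v e t p))"
  \<comment> \<open>\<open>D\<close> is both the time derivative of the rescaled density and the \<open>s\<close>-derivative of the flux \<open>G\<close>.\<close>
  define D where "D = (\<lambda>t s. - (\<Lambda> + \<mu>) * q t (P t s)
     + l t * (2 * inner (e t (P t s)) (et t (P t s) + (\<Lambda> - s * (\<Lambda> + \<mu>)) *\<^sub>R ep t (P t s))))"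
  \<comment> \<open>\<open>G\<close> is the flux relative to the moving frame: the point with
    parameter \<open>s\<close> has velocity \<open>\<Lambda> - s * (\<Lambda> + \<mu>)\<close>, that
    is \<Lambda> at the left end and - \<mu> at the right end.\<close>
  define G where "G = (\<lambda>t s. - inner (e t (P t s)) (H1 t *v e t (P t s))
     + (\<Lambda> - s * (\<Lambda> + \<mu>)) * q t (P t s))"
  note scaleC = bounded_bilinear_scale_complex
  note mulv = bounded_bilinear_matrix_vector_complex

  have conty: "continuous_on {0..T} (y k)" if "k \<in> I" for k
    using ode[OF that] by (rule continuous_on_vector_derivative)
  have cont_e: "continuous_on S (\<lambda>x. e (f x) (g x))" and cont_ep: "continuous_on S (\<lambda>x. ep (f x) (g x))"
    if "continuous_on S f" "f ` S \<subseteq> {0..T}" "continuous_on S g"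
    for f g :: "'c::topological_space \<Rightarrow> real" and S
    unfolding e_def ep_def using that
    by (auto intro!: continuous_intros continuous_on_scale_complex
        continuous_on_compose2[OF conty] simp: image_subset_iff)
  have cont_l: "continuous_on S (\<lambda>x. l (f x))"
    if "continuous_on S f" for f :: "'c::topological_space \<Rightarrow> real" and S
    unfolding l_def using that by (auto intro!: continuous_intros)
  have cont_P: "continuous_on S (\<lambda>x. P (f x) (g x))"
    if "continuous_on S f" "continuous_on S g"
    for f g :: "'c::topological_space \<Rightarrow> real" and S
    unfolding P_def using that by (auto intro!: continuous_intros cont_l)

  \<comment> \<open>The chain rule along a general curve serves twice: along \<open>P t s\<close>
    with fixed \<open>s\<close> for the time derivative, and at frozen time for the
    \<open>s\<close>-derivative.\<close>
  have e_deriv: "((\<lambda>t. e (f t) (g t)) has_vector_derivative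
      f' *\<^sub>R et (f t) (g t) + g' *\<^sub>R ep (f t) (g t)) (at t within S)"
    if f: "(f has_real_derivative f') (at t within S)" "f ` S \<subseteq> {0..T}" "t \<in> S"
      and g: "(g has_real_derivative g') (at t within S)" for f g f' g' t S
  proof -
    have "((\<lambda>t. (c k * exp (z k * of_real (g t))) *s y k (f t)) has_vector_derivative
        (c k * exp (z k * of_real (g t))) *s
            (f' *\<^sub>R (- z k *s (H1 (f t) *v y k (f t)) + \<i> *s (H2 (f t) *v y k (f t))))
        + (c k * (g' *\<^sub>R (z k * exp (z k * of_real (g t))))) *s y k (f t)) (at t within S)"
      if k: "k \<in> I" for k
    proof (rule bounded_bilinear.has_vector_derivative[OF scaleC])
      have "((y k \<circ> f) has_vector_derivative
          f' *\<^sub>R (- z k *s (H1 (f t) *v y k (f t)) + \<i> *s (H2 (f t) *v y k (f t)))) (at t within S)"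
      proof (rule vector_diff_chain_within)
        show "(f has_vector_derivative f') (at t within S)"
          using f by (simp add: has_real_derivative_iff_has_vector_derivative)
        show "(y k has_vector_derivative - z k *s (H1 (f t) *v y k (f t)) + \<i> *s (H2 (f t) *v y k (f t)))
            (at (f t) within f ` S)"
          using ode[OF k] f by (intro has_vector_derivative_within_subset[OF ode[OF k]]) auto
      qed
      then show "((\<lambda>t. y k (f t)) has_vector_derivative
          f' *\<^sub>R (- z k *s (H1 (f t) *v y k (f t)) + \<i> *s (H2 (f t) *v y k (f t)))) (at t within S)"
        by (simp add: o_def)
      have "((\<lambda>t. exp (z k * of_real t)) has_vector_derivative z k * exp (z k * of_real (g t)))
          (at (g t) within g ` S)"
        by (rule has_vector_derivative_real_field) (auto intro!: derivative_eq_intros)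
      then have "((\<lambda>t. exp (z k * of_real t)) \<circ> g has_vector_derivative
          g' *\<^sub>R (z k * exp (z k * of_real (g t)))) (at t within S)"
        using g by (intro vector_diff_chain_within)
          (simp_all add: has_real_derivative_iff_has_vector_derivative)
      then show "((\<lambda>t. c k * exp (z k * of_real (g t))) has_vector_derivative
          c k * (g' *\<^sub>R (z k * exp (z k * of_real (g t))))) (at t within S)"
        by (intro has_vector_derivative_mult_right) (simp add: o_def)
    qed
    then have "((\<lambda>t. e (f t) (g t)) has_vector_derivative
        (\<Sum>k\<in>I. (c k * exp (z k * of_real (g t))) *s
            (f' *\<^sub>R (- z k *s (H1 (f t) *v y k (f t)) + \<i> *s (H2 (f t) *v y k (f t))))
        + (c k * (g' *\<^sub>R (z k * exp (z k * of_real (g t))))) *s y k (f t))) (at t within S)"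
      unfolding e_def by (rule has_vector_derivative_sum)
    also have "(\<Sum>k\<in>I. (c k * exp (z k * of_real (g t))) *s
            (f' *\<^sub>R (- z k *s (H1 (f t) *v y k (f t)) + \<i> *s (H2 (f t) *v y k (f t))))
        + (c k * (g' *\<^sub>R (z k * exp (z k * of_real (g t))))) *s y k (f t))
        = f' *\<^sub>R et (f t) (g t) + g' *\<^sub>R ep (f t) (g t)"
      unfolding et_def ep_def e_def bounded_bilinear.sum_right[OF mulv] 
        bounded_bilinear.sum_right[OF scaleC] scaleR_sum_right sum_negf[symmetric] sum.distrib[symmetric]
      by (intro sum.cong refl)
         (simp add: vec_eq_iff matrix_vector_scale scaleR_conv_of_real[where 'a = complex] algebra_simps)
    finally show ?thesis .
  qed

  have q_deriv: "((\<lambda>t. q (f t) (g t)) has_real_derivative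
      2 * inner (e (f t) (g t)) (f' *\<^sub>R et (f t) (g t) + g' *\<^sub>R ep (f t) (g t))) (at t within S)"
    if "(f has_real_derivative f') (at t within S)" "f ` S \<subseteq> {0..T}" "t \<in> S"
      "(g has_real_derivative g') (at t within S)" for f g f' g' t S
    unfolding q_def has_real_derivative_iff_has_vector_derivative
    using bounded_bilinear.has_vector_derivative[OF bounded_bilinear_inner e_deriv[OF that] e_deriv[OF that]]
    by (simp add: inner_commute)

  have D_deriv: "((\<lambda>t. l t * q t (P t s)) has_real_derivative D t s) (at t within {0..T})"
    if t: "t \<in> {0..T}" for t s
  proof -
    have dl: "(l has_real_derivative - (\<Lambda> + \<mu>)) (at t within {0..T})"
      unfolding l_def by (auto intro!: derivative_eq_intros)
    have dP: "((\<lambda>t. P t s) has_real_derivative \<Lambda> - s * (\<Lambda> + \<mu>)) (at t within {0..T})"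
      unfolding P_def by (rule derivative_eq_intros dl refl)+ (simp add: algebra_simps)
    have "((\<lambda>t. q t (P t s)) has_real_derivative
        2 * inner (e t (P t s)) (et t (P t s) + (\<Lambda> - s * (\<Lambda> + \<mu>)) *\<^sub>R ep t (P t s)))
        (at t within {0..T})"
      using q_deriv[of "\<lambda>t. t" 1 t "{0..T}" "\<lambda>t. P t s"] dP t by auto
    from DERIV_mult[OF dl this] show ?thesis
      by (simp add: D_def algebra_simps)
  qed
  have G_deriv: "((\<lambda>s. G t s) has_real_derivative D t s) (at s within {0..1})"
    if t: "t \<in> {0..T}" and s: "s \<in> {0..1}" for t s
  proof -
    have P_deriv: "(P t has_real_derivative l t) (at s within {0..1})"
      unfolding P_def by (auto intro!: derivative_eq_intros)
    have de: "((\<lambda>s. e t (P t s)) has_vector_derivative l t *\<^sub>R ep t (P t s)) (at s within {0..1})"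
      using e_deriv[of "\<lambda>_. t" 0 s "{0..1}" "P t" "l t"] P_deriv t s by (auto simp: image_subset_iff)
    note dHe = bounded_linear.has_vector_derivative[OF bounded_bilinear.bounded_linear_right[OF mulv] de]
    have dq: "((\<lambda>s. q t (P t s)) has_real_derivative 2 * inner (e t (P t s)) (l t *\<^sub>R ep t (P t s)))
        (at s within {0..1})"
      using q_deriv[of "\<lambda>_. t" 0 s "{0..1}" "P t" "l t"] P_deriv t s by (auto simp: image_subset_iff)
    \<comment> \<open>Self-adjointness of \<open>H1 t\<close> merges the two terms of the product
      rule for the quadratic form.\<close>
    have sa: "inner (ep t (P t s)) (H1 t *v e t (P t s)) = inner (e t (P t s)) (H1 t *v ep t (P t s))"
      using inner_matrix_vector_cadjoint[of "ep t (P t s)" "H1 t"] unfolding herm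
      by (metis inner_commute)
    have dH: "((\<lambda>s. inner (e t (P t s)) (H1 t *v e t (P t s))) has_real_derivative
        2 * inner (e t (P t s)) (l t *\<^sub>R (H1 t *v ep t (P t s)))) (at s within {0..1})"
      unfolding has_real_derivative_iff_has_vector_derivative
      by (rule has_vector_derivative_eq_rhs[OF bounded_bilinear.has_vector_derivative[OF bounded_bilinear_inner de dHe]])
         (simp add: bounded_bilinear.scaleR_right[OF mulv] sa)
    have [simp]: "inner (e t (P t s)) (\<i> *s (H2 t *v e t (P t s))) = 0"
      by (rule inner_i_hermitian) (rule herm)
    show ?thesis unfolding G_def
      by (rule derivative_eq_intros dH dq refl)+
        (simp add: D_def et_def inner_simps algebra_simps)
  qed
  \<comment> \<open>The normalized form of \<open>H1 t\<close> lies between - \<mu> and \<Lambda>,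
    the velocities of the two ends, so energy can only leave: the flux is nonpositive at the right
    end and nonnegative at the left end.\<close>
  have G_mono: "G t 1 \<le> G t 0" if t: "t \<in> {0<..<T}" for t
  proof -
    have "G t 1 \<le> 0" using lower[OF t, of "e t (P t 1)"] by (simp add: G_def q_def algebra_simps)
    also have "0 \<le> G t 0" using upper[OF t, of "e t (P t 0)"] by (simp add: G_def q_def algebra_simps)
    finally show ?thesis .
  qed
  have l_nonneg: "0 \<le> l t" if "t \<in> {0..T}" for t
  proof -
    have "(\<Lambda> + \<mu>) * t \<le> (\<Lambda> + \<mu>) * T" using that ab by (intro mult_left_mono) auto
    then show ?thesis using ab by (simp add: l_def algebra_simps)
  qed
  define E where "E = (\<lambda>t. integral {0..1} (\<lambda>s. l t * q t (P t s)))"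
  have E_deriv: "(E has_real_derivative G t 1 - G t 0) (at t within {0..T})" if t: "t \<in> {0..T}" for t
  proof -
    have "((\<lambda>t. integral (cbox 0 1) (\<lambda>s. l t * q t (P t s))) has_real_derivative
        integral (cbox 0 1) (D t)) (at t within {0..T})"
    proof (rule leibniz_rule_field_derivative)
      show "(\<lambda>s. l t * q t (P t s)) integrable_on cbox 0 1" if "t \<in> {0..T}" for t
        unfolding q_def using that
        by (intro integrable_continuous continuous_intros cont_e cont_l cont_P) auto
      show "continuous_on ({0..T} \<times> cbox 0 1) (\<lambda>(t, s). D t s)"
        unfolding D_def et_def q_def case_prod_beta
        by (intro continuous_intros cont_e cont_ep cont_l cont_P continuous_on_matrix_vector_complex
            continuous_on_scale_complex continuous_on_compose2[OF cont(1)]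
            continuous_on_compose2[OF cont(2)]) auto
    qed (use t D_deriv in auto)
    \<comment> \<open>Since \<open>D t\<close> is also the \<open>s\<close>-derivative of
      \<open>G t\<close>, integrating it leaves only the boundary fluxes.\<close>
    moreover have "(D t has_integral (G t 1 - G t 0)) {0..1}"
      by (rule fundamental_theorem_of_calculus)
        (use G_deriv[OF t] in \<open>auto simp: has_real_derivative_iff_has_vector_derivative\<close>)
    ultimately show ?thesis by (simp add: E_def integral_unique)
  qed
  have "E T \<le> E 0"
  \<comment> \<open>The form bounds are available at interior times only, just as
    \<open>lambda_max_plus\<close> is a supremum over the open interval.\<close>
  proof (rule DERIV_nonpos_imp_decreasing_open[OF T])
    show "\<exists>y. (E has_real_derivative y) (at t) \<and> y \<le> 0" if "0 < t" "t < T" for t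
      using E_deriv[of t] G_mono[of t] that by (auto simp: at_within_Icc_at)
    show "continuous_on {0..T} E" using E_deriv by (rule DERIV_continuous_on)
  qed
  moreover have "E t = integral {a + \<Lambda> * t..b - \<mu> * t} (\<lambda>p. (norm (e t p))\<^sup>2)" if t: "t \<in> {0..T}" for t
  proof -
    have "((\<lambda>s. l t *\<^sub>R q t (P t s)) has_integral integral {P t 0..P t 1} (q t)) {0..1}"
    proof (rule has_integral_substitution)
      show "P t 0 \<le> P t 1" using l_nonneg[OF t] by (simp add: P_def)
      show "P t ` {0..1} \<subseteq> {P t 0..P t 1}"
        using l_nonneg[OF t] by (auto simp: P_def mult_left_le_one_le)
      show "continuous_on {P t 0..P t 1} (q t)"
        unfolding q_def using t by (intro continuous_intros cont_e) auto
      show "(P t has_real_derivative l t) (at s within {0..1})" for s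
        unfolding P_def by (auto intro!: derivative_eq_intros)
    qed simp
    moreover have "P t 0 = a + \<Lambda> * t" "P t 1 = b - \<mu> * t"
      by (simp_all add: P_def l_def algebra_simps)
    moreover have "q t = (\<lambda>p. (norm (e t p))\<^sup>2)" by (simp add: q_def power2_norm_eq_inner)
    ultimately show ?thesis by (simp add: E_def integral_unique del: integral_mult_right)
  qed
  ultimately show ?thesis using T by simp
qed

section \<open>Scalar quadrature error\<close>

text \<open>At \<open>\<xi> = node X N j\<close> this is \<open>xi_vec X N j\<close> times the phase
  of the reconstruction, so the reconstruction at time 0 is a trapezoidal sum of
  \<open>resolvent_mode p\<close> times the initial vector.\<close>

definition resolvent_mode :: "real \<Rightarrow> real \<Rightarrow> complex" where
  "resolvent_mode p \<xi> = exp (- \<i> * of_real (\<xi> * p)) / of_real (pi * (1 + \<xi>\<^sup>2))"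

lemma resolvent_mode_deriv:
  "(resolvent_mode p has_vector_derivative
     (- \<i> * of_real p - of_real (2 * \<xi> / (1 + \<xi>\<^sup>2))) * resolvent_mode p \<xi>) (at \<xi> within S)"
proof -
  have nz: "1 + \<xi>\<^sup>2 \<noteq> 0" by (smt (verit) zero_le_power2)
  have nz': "1 + (complex_of_real \<xi>)\<^sup>2 \<noteq> 0"
    using nz by (metis of_real_1 of_real_add of_real_eq_0_iff of_real_power)
  have "((\<lambda>z. exp (- \<i> * (z * of_real p)) / (of_real pi * (1 + z\<^sup>2))) has_field_derivative
     (- \<i> * of_real p - of_real (2 * \<xi> / (1 + \<xi>\<^sup>2))) * resolvent_mode p \<xi>) (at (of_real \<xi>))"
    unfolding resolvent_mode_def
    using nz' by (auto intro!: derivative_eq_intros simp: divide_simps power2_eq_square)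
      (simp add: algebra_simps)
  from has_vector_derivative_real_field[OF this[THEN has_field_derivative_at_within]]
  show ?thesis unfolding resolvent_mode_def[abs_def] by simp
qed

lemma norm_resolvent_mode: "norm (resolvent_mode p \<xi>) = 1 / (pi * (1 + \<xi>\<^sup>2))"
proof -
  have "norm (exp (- \<i> * of_real (\<xi> * p))) = 1" by simp
  moreover have "0 < pi * (1 + \<xi>\<^sup>2)" by (simp add: add_pos_nonneg)
  ultimately show ?thesis by (simp only: resolvent_mode_def norm_divide norm_of_real abs_of_pos)
qed

text \<open>The derivative has modulus at most \<open>(p + 1) / (pi * (1 + \<xi>\<^sup>2))\<close>,
  which is the derivative of the arctan majorant. Boundedness of arctan then bounds the variation
  uniformly in \<open>X\<close>.\<close>

lemma resolvent_mode_variation: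
  assumes "0 \<le> p" "x \<le> y"
  shows "norm (resolvent_mode p y - resolvent_mode p x) \<le> (p + 1) / pi * arctan y - (p + 1) / pi * arctan x"
proof (cases "x = y")
  case False
  then have "x < y" using assms by simp
  then show ?thesis
  proof (rule differentiable_bound_general)
    show "continuous_on {x..y} (resolvent_mode p)"
      by (rule continuous_on_vector_derivative) (rule resolvent_mode_deriv)
    show "continuous_on {x..y} (\<lambda>x. (p + 1) / pi * arctan x)" by (intro continuous_intros)
    show "(resolvent_mode p has_vector_derivative
     (- \<i> * of_real p - of_real (2 * \<xi> / (1 + \<xi>\<^sup>2))) * resolvent_mode p \<xi>) (at \<xi>)" for \<xi>
      by (rule resolvent_mode_deriv)
    show "((\<lambda>x. (p + 1) / pi * arctan x) has_vector_derivative (p + 1) / pi * inverse (1 + \<xi>\<^sup>2)) (at \<xi>)" for \<xi>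
      unfolding has_real_derivative_iff_has_vector_derivative[symmetric]
      by (auto intro!: derivative_eq_intros)
    show "norm ((- \<i> * of_real p - of_real (2 * \<xi> / (1 + \<xi>\<^sup>2))) * resolvent_mode p \<xi>)
        \<le> (p + 1) / pi * inverse (1 + \<xi>\<^sup>2)" for \<xi>
    proof -
      have "\<bar>2 * \<xi> / (1 + \<xi>\<^sup>2)\<bar> \<le> 1"
        using sum_squares_bound[of "1" "\<bar>\<xi>\<bar>"] by (simp add: divide_le_eq add_pos_nonneg abs_mult)
      then have "norm (- \<i> * of_real p - of_real (2 * \<xi> / (1 + \<xi>\<^sup>2))) \<le> p + 1"
        using norm_triangle_ineq4[of "- \<i> * of_real p" "of_real (2 * \<xi> / (1 + \<xi>\<^sup>2))"] assms(1)
        by (simp add: norm_mult del: of_real_divide)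
      then have "norm (- \<i> * of_real p - of_real (2 * \<xi> / (1 + \<xi>\<^sup>2))) * (1 / (pi * (1 + \<xi>\<^sup>2)))
          \<le> (p + 1) * (1 / (pi * (1 + \<xi>\<^sup>2)))"
        by (rule mult_right_mono) (simp add: add_nonneg_nonneg)
      then show ?thesis by (simp add: norm_mult norm_resolvent_mode divide_inverse mult_ac)
    qed
  qed
qed simp

section \<open>Trapezoidal rule for functions of bounded variation\<close>

lemma trapezoid_cell_error:
  fixes f :: "real \<Rightarrow> complex"
  assumes "a \<le> b" and cont: "continuous_on {a..b} f"
    and var: "\<And>x y. x \<le> y \<Longrightarrow> norm (f y - f x) \<le> G y - G x"
  shows "norm (((b - a) / 2) *\<^sub>R (f a + f b) - integral {a..b} f) \<le> (b - a) * (G b - G a)"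
proof -
  have mono: "G x \<le> G y" if "x \<le> y" for x y :: real
    using var[OF that] norm_ge_zero[of "f y - f x"] by linarith
  have "((\<lambda>x. (1 / 2) *\<^sub>R (f a + f b) - f x) has_integral
      (b - a) *\<^sub>R ((1 / 2) *\<^sub>R (f a + f b)) - integral {a..b} f) {a..b}"
    using has_integral_diff[OF has_integral_const_real[of "(1 / 2) *\<^sub>R (f a + f b)" a b]
        integrable_integral[OF integrable_continuous_real[OF cont]]] assms(1)
    by simp
  then have "norm ((b - a) *\<^sub>R ((1 / 2) *\<^sub>R (f a + f b)) - integral {a..b} f)
      \<le> (G b - G a) * measure lborel (cbox a b)"
  proof (intro has_integral_bound)
    show "0 \<le> G b - G a" using mono[OF assms(1)] by simp
    show "norm ((1 / 2) *\<^sub>R (f a + f b) - f x) \<le> G b - G a" if "x \<in> cbox a b" for x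
    proof -
      \<comment> \<open>The deviation from the mean of the end values is half the difference of the
        increments over the two parts of the cell, and \<open>G\<close> controls each of
        them.\<close>
      have "(1 / 2) *\<^sub>R (f a + f b) - f x = (1 / 2) *\<^sub>R ((f b - f x) - (f x - f a))"
        by (simp add: scaleR_conv_of_real field_simps)
      then have "norm ((1 / 2) *\<^sub>R (f a + f b) - f x) \<le> (1 / 2) * (norm (f b - f x) + norm (f x - f a))"
        using norm_triangle_ineq4[of "f b - f x" "f x - f a"] by simp
      also have "\<dots> \<le> (1 / 2) * (G b - G a)"
        using var[of x b] var[of a x] that by simp
      also have "\<dots> \<le> G b - G a" using mono[OF assms(1)] by simp
      finally show ?thesis .
    qed
  qed (simp_all add: cbox_interval)
  then show ?thesis using assms(1) by (simp add: mult.commute)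
qed

text \<open>The cell errors add up while the increments of \<open>G\<close> telescope, so only
  \<open>h\<close> times the total increment remains.\<close>

lemma trapezoid_error:
  fixes f :: "real \<Rightarrow> complex"
  assumes "0 \<le> h" and cont: "\<And>S. continuous_on S f"
    and var: "\<And>x y. x \<le> y \<Longrightarrow> norm (f y - f x) \<le> G y - G x"
  shows "norm ((\<Sum>j<n. (h / 2) *\<^sub>R (f (a + real j * h) + f (a + real (Suc j) * h)))
      - integral {a..a + real n * h} f) \<le> h * (G (a + real n * h) - G a)"
proof (induction n)
  case (Suc n)
  let ?b = "a + real n * h" and ?c = "a + real (Suc n) * h"
  have bc: "a \<le> ?b" "?b \<le> ?c" "?c - ?b = h" using assms(1) by (simp_all add: algebra_simps)
  have int: "integral {a..?c} f = integral {a..?b} f + integral {?b..?c} f"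
    using Henstock_Kurzweil_Integration.integral_combine[OF bc(1,2) integrable_continuous_real[OF cont]] by simp
  have cell: "norm ((h / 2) *\<^sub>R (f ?b + f ?c) - integral {?b..?c} f) \<le> h * (G ?c - G ?b)"
    using trapezoid_cell_error[OF bc(2) cont var] unfolding bc(3) .
  have "norm ((\<Sum>j<Suc n. (h / 2) *\<^sub>R (f (a + real j * h) + f (a + real (Suc j) * h)))
      - integral {a..?c} f)
    = norm (((\<Sum>j<n. (h / 2) *\<^sub>R (f (a + real j * h) + f (a + real (Suc j) * h)))
      - integral {a..?b} f) + ((h / 2) *\<^sub>R (f ?b + f ?c) - integral {?b..?c} f))"
    unfolding int sum.lessThan_Suc by (simp only: algebra_simps)
  also have "\<dots> \<le> h * (G ?b - G a) + h * (G ?c - G ?b)"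
    by (rule norm_triangle_mono[OF Suc.IH cell])
  finally show ?case by (simp only: algebra_simps)
qed simp

lemma sum_adjacent_eq_trapezoid:
  fixes g :: "nat \<Rightarrow> 'a::real_vector"
  assumes "0 < N"
  shows "(\<Sum>j<N. (h / 2) *\<^sub>R (g j + g (Suc j))) = (\<Sum>j\<le>N. (if j = 0 \<or> j = N then h / 2 else h) *\<^sub>R g j)"
proof -
  have A: "(\<Sum>j<N. (h / 2) *\<^sub>R (g j + g (Suc j))) = (\<Sum>j\<le>N. h *\<^sub>R g j) - (h / 2) *\<^sub>R (g 0 + g N)" for N
  proof (induction N)
    case (Suc N)
    have "h *\<^sub>R x = (h / 2) *\<^sub>R x + (h / 2) *\<^sub>R x" for x :: 'a
      by (simp flip: scaleR_left.add)
    with Suc show ?case by (simp add: algebra_simps)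
  qed (simp flip: scaleR_left.add scaleR_2)
  have "(\<Sum>j\<le>N. (if j = 0 \<or> j = N then h / 2 else h) *\<^sub>R g j)
      = (\<Sum>j\<le>N. h *\<^sub>R g j - (if j = 0 then (h / 2) *\<^sub>R g 0 else 0) - (if j = N then (h / 2) *\<^sub>R g N else 0))"
  proof (rule sum.cong[OF refl])
    fix j
    have "h *\<^sub>R x = (h / 2) *\<^sub>R x + (h / 2) *\<^sub>R x" for x :: 'a
      by (simp flip: scaleR_left.add)
    then show "(if j = 0 \<or> j = N then h / 2 else h) *\<^sub>R g j = h *\<^sub>R g j
        - (if j = 0 then (h / 2) *\<^sub>R g 0 else 0) - (if j = N then (h / 2) *\<^sub>R g N else 0)"
      using assms by (auto simp: algebra_simps)
  qed
  also have "\<dots> = (\<Sum>j\<le>N. h *\<^sub>R g j) - (h / 2) *\<^sub>R g 0 - (h / 2) *\<^sub>R g N"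
    by (simp add: sum_subtractf)
  finally show ?thesis unfolding A by (simp only: scaleR_add_right diff_diff_add)
qed

lemma trapezoid_resolvent_error:
  assumes p: "0 \<le> p" and X: "0 < X" and N: "0 < N"
  shows "norm ((\<Sum>j\<le>N. (if j = 0 \<or> j = N then mesh X N / 2 else mesh X N) *\<^sub>R resolvent_mode p (node X N j))
      - integral {-X..X} (resolvent_mode p)) \<le> (p + 1) * mesh X N"
proof -
  let ?G = "\<lambda>x. (p + 1) / pi * arctan x"
  have nd: "node X N j = - X + real j * mesh X N" for j by (simp add: node_def mesh_def)
  have top: "- X + real N * mesh X N = X" using N by (simp add: mesh_def)
  have h: "0 \<le> mesh X N" using X by (simp add: mesh_def)
  have "norm ((\<Sum>j\<le>N. (if j = 0 \<or> j = N then mesh X N / 2 else mesh X N) *\<^sub>R resolvent_mode p (node X N j))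
      - integral {-X..X} (resolvent_mode p)) \<le> mesh X N * (?G X - ?G (- X))"
    using trapezoid_error[OF h, where f = "resolvent_mode p" and G = ?G and n = N and a = "- X"]
      continuous_on_vector_derivative[OF resolvent_mode_deriv] resolvent_mode_variation[OF p]
    unfolding sum_adjacent_eq_trapezoid[OF N, symmetric] nd top by blast
  \<comment> \<open>The arctan increment stays below \<open>pi\<close> on every symmetric interval,
    so the factor of the mesh size does not grow with \<open>X\<close>.\<close>
  also have "?G X - ?G (- X) \<le> p + 1"
  proof -
    have "(p + 1) / pi * (2 * arctan X) \<le> (p + 1) / pi * pi"
      using arctan_ubound[of X] p by (intro mult_left_mono) auto
    then show ?thesis by (simp add: arctan_minus mult_ac)
  qed
  then have "mesh X N * (?G X - ?G (- X)) \<le> mesh X N * (p + 1)"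
    using h by (rule mult_left_mono)
  finally show ?thesis by (simp add: mult.commute)
qed

section \<open>Truncation of the Fourier integral by Cauchy's theorem\<close>

lemma norm_square_ge_on_diamond:
  assumes "0 < X" "\<bar>Re z\<bar> + \<bar>Im z\<bar> = X"
  shows "X\<^sup>2 / 2 \<le> (norm z)\<^sup>2"
proof -
  have "0 \<le> (\<bar>Re z\<bar> - \<bar>Im z\<bar>)\<^sup>2" by simp
  then show ?thesis
    unfolding cmod_power2 assms(2)[symmetric] by (simp add: power2_eq_square algebra_simps)
qed

text \<open>Both exponentials have modulus at most 1 in the upper half-plane, which gives 2 in the
  numerator. The denominator is \<open>z\<^sup>2 + 1\<close>, of modulus at least
  \<open>X\<^sup>2 / 2 - 1 \<ge> X\<^sup>2 / 4\<close> because \<open>X \<ge> 2\<close>.\<close>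

lemma exp_quotient_bound_on_diamond:
  assumes p: "0 \<le> p" and X: "2 \<le> X" and z: "0 \<le> Im z" "\<bar>Re z\<bar> + \<bar>Im z\<bar> = X" "z \<noteq> \<i>"
  shows "norm ((exp (\<i> * z * of_real p) - exp (- of_real p)) / ((z - \<i>) * (z + \<i>))) \<le> 8 / X\<^sup>2"
proof -
  have "(z - \<i>) * (z + \<i>) = z\<^sup>2 - (-1)" by (simp add: algebra_simps power2_eq_square)
  then have "norm ((z - \<i>) * (z + \<i>)) \<ge> (norm z)\<^sup>2 - 1"
    using norm_triangle_ineq2[of "z\<^sup>2" "-1"] by (simp add: norm_power)
  moreover have "X\<^sup>2 / 2 \<le> (norm z)\<^sup>2" using norm_square_ge_on_diamond[of X z] X z by simp
  moreover have "4 \<le> X\<^sup>2" using power_mono[OF X, of 2] by simp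
  ultimately have den: "X\<^sup>2 / 4 \<le> norm ((z - \<i>) * (z + \<i>))" by linarith
  have "norm (exp (\<i> * z * of_real p)) \<le> 1" using z p by simp
  moreover have "norm (exp (- complex_of_real p)) \<le> 1" using p by simp
  ultimately have num: "norm (exp (\<i> * z * of_real p) - exp (- of_real p)) \<le> 2"
    using norm_triangle_ineq4[of "exp (\<i> * z * of_real p)" "exp (- complex_of_real p)"] by linarith
  have "norm ((exp (\<i> * z * of_real p) - exp (- of_real p)) / ((z - \<i>) * (z + \<i>)))
      \<le> 2 / (X\<^sup>2 / 4)"
    unfolding norm_divide using num den X by (intro frac_le) auto
  then show ?thesis by simp
qed

lemma segment_real_to_imaginary:
  assumes "0 < X" and r: "r = 1 \<or> r = - 1"
    and z: "z \<in> closed_segment (of_real (r * X)) (\<i> * of_real X)"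
  shows "0 \<le> Im z" "\<bar>Re z\<bar> + \<bar>Im z\<bar> = X"
proof -
  obtain u where u: "0 \<le> u" "u \<le> 1" "z = (1 - u) *\<^sub>R of_real (r * X) + u *\<^sub>R (\<i> * of_real X)"
    using z by (auto simp: closed_segment_def)
  have ReIm: "Re z = (1 - u) * (r * X)" "Im z = u * X" unfolding u(3) by simp_all
  show "0 \<le> Im z" using u assms(1) by (simp add: ReIm)
  have "\<bar>r\<bar> = 1" using r by auto
  then show "\<bar>Re z\<bar> + \<bar>Im z\<bar> = X"
    using assms(1) u(1,2) by (simp only: ReIm abs_mult) (simp add: algebra_simps)
qed

text \<open>Subtracting \<open>exp (- p)\<close> removes the pole at \<open>\<i>\<close>. Cauchy's
  theorem on the triangle with vertices - X, X and i X then moves the real segment to the two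
  slanted sides, each of which contributes at most 16 / X.\<close>

lemma truncated_cauchy_exp_bound:
  assumes p: "0 \<le> p" and X: "2 \<le> X"
  shows "norm (integral {-X..X} (\<lambda>x. (exp (\<i> * of_real (x * p)) - exp (- of_real p)) / of_real (1 + x\<^sup>2)))
    \<le> 32 / X"
proof -
  define f :: "complex \<Rightarrow> complex" where "f = (\<lambda>z. exp (\<i> * z * of_real p))"
  define S where "S = {z. - (1/2) < Im z}"
  \<comment> \<open>Filling in the derivative at \<open>\<i>\<close> makes the first factor
    holomorphic; the other pole, at \<open>- \<i>\<close>, lies outside \<open>S\<close>.\<close>
  define h where "h = (\<lambda>z. (if z = \<i> then deriv f \<i> else (f z - f \<i>) / (z - \<i>)) / (z + \<i>))"
  have "open S" unfolding S_def by (rule open_halfspace_Im_gt)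
  have "convex S" unfolding S_def by (rule convex_halfspace_Im_gt)
  have "(\<lambda>z. if z = \<i> then deriv f \<i> else (f z - f \<i>) / (z - \<i>)) holomorphic_on S"
    by (rule pole_lemma_open[OF _ \<open>open S\<close>]) (auto simp: f_def intro!: holomorphic_intros)
  moreover have "z + \<i> \<noteq> 0" if "z \<in> S" for z
    using that by (auto simp: S_def complex_eq_iff)
  ultimately have hol: "h holomorphic_on S"
    unfolding h_def by (intro holomorphic_intros) auto
  let ?a = "of_real (- X) :: complex" and ?b = "of_real X :: complex" and ?c = "\<i> * of_real X"
  have hull: "convex hull {?a, ?b, ?c} \<subseteq> S"
    using X \<open>convex S\<close> by (intro hull_minimal) (auto simp: S_def)
  have seg: "closed_segment x y \<subseteq> S" if "x \<in> {?a, ?b, ?c}" "y \<in> {?a, ?b, ?c}" for x y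
    using that X by (intro closed_segment_subset[OF _ _ \<open>convex S\<close>]) (auto simp: S_def)
  have int: "h contour_integrable_on linepath x y" if "x \<in> {?a, ?b, ?c}" "y \<in> {?a, ?b, ?c}" for x y
    by (rule contour_integrable_continuous_linepath)
       (rule continuous_on_subset[OF holomorphic_on_imp_continuous_on[OF hol] seg[OF that]])
  have "(h has_contour_integral 0) (linepath ?a ?b +++ linepath ?b ?c +++ linepath ?c ?a)"
    by (rule Cauchy_theorem_triangle[OF holomorphic_on_subset[OF hol hull]])
  then have "contour_integral (linepath ?a ?b +++ linepath ?b ?c +++ linepath ?c ?a) h = 0"
    by (rule contour_integral_unique)
  then have sum0: "contour_integral (linepath ?a ?b) h + (contour_integral (linepath ?b ?c) h
      + contour_integral (linepath ?c ?a) h) = 0"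
    using int by (simp add: contour_integrable_joinI)
  have hval: "h z = (exp (\<i> * z * of_real p) - exp (- of_real p)) / ((z - \<i>) * (z + \<i>))" if "z \<noteq> \<i>" for z
    using that by (simp add: h_def f_def)
  have bd: "norm (h z) \<le> 8 / X\<^sup>2" if "0 \<le> Im z" "\<bar>Re z\<bar> + \<bar>Im z\<bar> = X" for z
  proof -
    have "z \<noteq> \<i>" using that X by auto
    then show ?thesis using exp_quotient_bound_on_diamond[OF p X that] by (simp add: hval)
  qed
  have len: "norm (?c - ?b) \<le> 2 * X" "norm (?a - ?c) \<le> 2 * X"
    using norm_triangle_ineq4[of ?c ?b] norm_triangle_ineq4[of ?a ?c] X by (simp_all add: norm_mult)
  have "norm (contour_integral (linepath ?b ?c) h) \<le> 8 / X\<^sup>2 * norm (?c - ?b)"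
    using segment_real_to_imaginary[of X 1] X
    by (intro contour_integral_bound_linepath int bd) auto
  also have "\<dots> \<le> 8 / X\<^sup>2 * (2 * X)" by (rule mult_left_mono[OF len(1)]) simp
  finally have 1: "norm (contour_integral (linepath ?b ?c) h) \<le> 16 / X"
    using X by (simp add: power2_eq_square)
  have "norm (contour_integral (linepath ?c ?a) h) \<le> 8 / X\<^sup>2 * norm (?a - ?c)"
    using segment_real_to_imaginary[of X "- 1"] X
    by (intro contour_integral_bound_linepath int bd) (auto simp: closed_segment_commute)
  also have "\<dots> \<le> 8 / X\<^sup>2 * (2 * X)" by (rule mult_left_mono[OF len(2)]) simp
  finally have 2: "norm (contour_integral (linepath ?c ?a) h) \<le> 16 / X"
    using X by (simp add: power2_eq_square)
  have "contour_integral (linepath ?a ?b) h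
      = - (contour_integral (linepath ?b ?c) h + contour_integral (linepath ?c ?a) h)"
    using sum0 by (simp add: add_eq_0_iff2)
  then have "norm (contour_integral (linepath ?a ?b) h) \<le> 32 / X"
    using norm_triangle_ineq[of "contour_integral (linepath ?b ?c) h" "contour_integral (linepath ?c ?a) h"] 1 2
    by (simp only: norm_minus_cancel)
  moreover have "contour_integral (linepath ?a ?b) h = integral {-X..X} (\<lambda>x. h (of_real x))"
    using X by (subst contour_integral_linepath_Reals_eq) auto
  moreover have "h (of_real x) = (exp (\<i> * of_real (x * p)) - exp (- of_real p)) / of_real (1 + x\<^sup>2)" for x
  proof -
    have "complex_of_real x \<noteq> \<i>" by (auto simp: complex_eq_iff)
    then show ?thesis by (simp add: hval algebra_simps power2_eq_square)
  qed
  ultimately show ?thesis by simp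
qed

lemma arctan_le_self:
  assumes "0 \<le> x" shows "arctan x \<le> x"
proof -
  have "0 - arctan 0 \<le> x - arctan x"
    by (rule DERIV_nonneg_imp_nondecreasing[OF assms])
       (auto intro!: derivative_eq_intros exI simp: inverse_le_1_iff)
  then show ?thesis by simp
qed

lemma arctan_tail: "0 < X \<Longrightarrow> pi / 2 - arctan X \<le> 1 / X"
  using arctan_inverse[of X] arctan_le_self[of "1 / X"] by (simp add: inverse_eq_divide)

text \<open>For \<open>X \<ge> 2\<close> the numerator is split as
  \<open>(exp (\<i> x p) - exp (- p)) + exp (- p)\<close>: the first part costs 32 / X by Cauchy's
  theorem and the missing arctan tails of the second cost 2 / X. For smaller \<open>X\<close> the
  crude bound 5 is already below 34 / X.\<close>

lemma truncated_resolvent_integral: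
  assumes p: "0 \<le> p" and X: "0 < X"
  shows "norm (integral {-X..X} (resolvent_mode p) - exp (- of_real p)) \<le> 34 / X"
proof (cases "2 \<le> X")
  case True
  let ?g = "\<lambda>x. (exp (\<i> * of_real (x * p)) - exp (- of_real p)) / of_real (1 + x\<^sup>2)"
  have nz: "1 + (x::real)\<^sup>2 \<noteq> 0" for x by (smt (verit) zero_le_power2)
  have nz': "1 + (complex_of_real x)\<^sup>2 \<noteq> 0" for x
    using nz[of x] by (metis of_real_1 of_real_add of_real_eq_0_iff of_real_power)
  have cont: "continuous_on {-X..X} ?g" "continuous_on {-X..X} (\<lambda>x. 1 / (1 + x\<^sup>2))"
    using nz nz' by (auto intro!: continuous_intros)
  have "((\<lambda>x. 1 / (1 + x\<^sup>2)) has_integral (arctan X - arctan (- X))) {-X..X}"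
    using X by (intro fundamental_theorem_of_calculus)
      (auto simp: has_real_derivative_iff_has_vector_derivative[symmetric] divide_inverse
        intro!: derivative_eq_intros)
  then have "((\<lambda>x. of_real (1 / (1 + x\<^sup>2))) has_integral complex_of_real (2 * arctan X)) {-X..X}"
    by (intro has_integral_of_real) (simp add: arctan_minus)
  then have I: "((\<lambda>x. (1 / of_real pi) * (?g x + exp (- of_real p) * of_real (1 / (1 + x\<^sup>2)))) has_integral
      (1 / of_real pi) * (integral {-X..X} ?g + exp (- of_real p) * of_real (2 * arctan X))) {-X..X}"
    by (intro has_integral_mult_right has_integral_add integrable_integral
        integrable_continuous_real cont)
  \<comment> \<open>The Cauchy bound concerns the phase with the opposite sign; reflecting the
    symmetric interval reconciles the two.\<close>
  have "(1 / of_real pi) * (?g x + exp (- of_real p) * of_real (1 / (1 + x\<^sup>2))) = resolvent_mode p (- x)" for x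
  proof -
    have "(y - z) / d + z * (1 / d) = y / d" for y z d :: complex
      by (simp add: diff_divide_distrib)
    then show ?thesis
      by (simp only: of_real_divide of_real_1) (simp add: resolvent_mode_def)
  qed
  with I have "integral {-X..X} (\<lambda>x. resolvent_mode p (- x))
      = (1 / of_real pi) * (integral {-X..X} ?g + exp (- of_real p) * of_real (2 * arctan X))"
    by (simp add: integral_unique)
  then have "integral {-X..X} (resolvent_mode p)
      = (1 / of_real pi) * (integral {-X..X} ?g + exp (- of_real p) * of_real (2 * arctan X))"
    using Henstock_Kurzweil_Integration.integral_reflect_real[of X "- X" "resolvent_mode p"] by simp
  then have "integral {-X..X} (resolvent_mode p) - exp (- of_real p)
      = (1 / of_real pi) * (integral {-X..X} ?g - exp (- of_real p) * of_real (pi - 2 * arctan X))"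
    by (simp add: field_simps)
  then have "norm (integral {-X..X} (resolvent_mode p) - exp (- of_real p))
      = (1 / pi) * norm (integral {-X..X} ?g - exp (- of_real p) * of_real (pi - 2 * arctan X))"
    by (simp add: norm_divide norm_mult)
  also have "\<dots> \<le> 1 * norm (integral {-X..X} ?g - exp (- of_real p) * of_real (pi - 2 * arctan X))"
    using pi_ge_two by (intro mult_right_mono) auto
  also have "\<dots> \<le> norm (integral {-X..X} ?g) + norm (exp (- of_real p) * complex_of_real (pi - 2 * arctan X))"
    using norm_triangle_ineq4 by simp
  also have "norm (exp (- of_real p) * complex_of_real (pi - 2 * arctan X)) \<le> 1 * (2 / X)"
  proof -
    have "norm (complex_of_real (pi - 2 * arctan X)) \<le> 2 / X"
      using arctan_tail[OF X] arctan_ubound[of X] by (simp only: norm_of_real)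
    moreover have "norm (exp (- complex_of_real p)) \<le> 1" using p by simp
    ultimately show ?thesis unfolding norm_mult by (intro mult_mono) auto
  qed
  finally show ?thesis using truncated_cauchy_exp_bound[OF p True] by (simp add: field_simps)
next
  case False
  have "norm (resolvent_mode p x) \<le> 1" for x
  proof -
    have "1 * 1 \<le> pi * (1 + x\<^sup>2)" using pi_ge_two by (intro mult_mono) auto
    then show ?thesis by (simp add: norm_resolvent_mode)
  qed
  then have "norm (integral {-X..X} (resolvent_mode p)) \<le> 1 * (X - (- X))"
    using X by (intro integral_bound continuous_on_vector_derivative[OF resolvent_mode_deriv]) auto
  then have "norm (integral {-X..X} (resolvent_mode p)) \<le> 4"
    using False by simp
  moreover have "norm (exp (- complex_of_real p)) \<le> 1" using p by simp
  ultimately have "norm (integral {-X..X} (resolvent_mode p) - exp (- of_real p)) \<le> 4 + 1"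
    by (intro norm_triangle_le_diff add_mono)
  also have "4 + 1 \<le> 34 / X" using False X by (simp add: field_simps)
  finally show ?thesis .
qed

section \<open>The recovery error\<close>

lemma trapezoid_reconstruction_eq_sum:
  assumes "0 < N"
  shows "trapezoid_reconstruction X N v p
    = (\<Sum>j\<le>N. (of_real (if j = 0 \<or> j = N then mesh X N / 2 else mesh X N)
        * exp (- \<i> * of_real (node X N j * p))) *s v j)"
proof -
  let ?t = "\<lambda>j. (of_real (if j = 0 \<or> j = N then mesh X N / 2 else mesh X N)
        * exp (- \<i> * of_real (node X N j * p))) *s v j"
  have "{..N} = insert 0 (insert N {1..N - 1})" using assms by auto
  then have "sum ?t {..N} = ?t 0 + (?t N + sum ?t {1..N - 1})"
    using assms by simp
  also have "sum ?t {1..N - 1}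
      = mesh X N *\<^sub>R (\<Sum>j = 1..N - 1. exp (- \<i> * of_real (node X N j * p)) *s v j)"
    unfolding scaleR_sum_right by (rule sum.cong) (auto simp: scaleR_eq_scale_complex)
  finally show ?thesis
    unfolding trapezoid_reconstruction_def
    by (simp add: scaleR_add_right scaleR_eq_scale_complex vector_add_ldistrib add_ac)
qed

text \<open>Both Kronecker factors are diagonal in the block index, so the blocks decouple, and
  block \<open>j\<close> obeys the mode equation with
  \<open>z = - \<i> * node X N j\<close>.\<close>

lemma block_apply_fourier:
  assumes "j \<le> N"
  shows "block_apply N (\<lambda>k l. cscale \<i> (kron_mat (D_xi X N) P k l + kron_mat Id_xi Q k l)) v j
    = (\<i> * of_real (node X N j)) *s (P *v v j) + \<i> *s (Q *v v j)"
proof -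
  have "block_apply N (\<lambda>k l. cscale \<i> (kron_mat (D_xi X N) P k l + kron_mat Id_xi Q k l)) v j
      = (\<Sum>k\<le>N. if j = k then (\<i> * of_real (node X N j)) *s (P *v v j) + \<i> *s (Q *v v j) else 0)"
    unfolding block_apply_def
    by (intro sum.cong refl)
      (auto simp: kron_mat_def D_xi_def Id_xi_def cscale_matrix_vector matrix_vector_mult_add_rdistrib
        vector_add_ldistrib)
  also have "\<dots> = (\<i> * of_real (node X N j)) *s (P *v v j) + \<i> *s (Q *v v j)"
    using assms by simp
  finally show ?thesis .
qed

text \<open>With \<open>\<gamma> = 1 / s\<close> the constant lower block \<open>s r0\<close>
  reproduces the source \<open>b\<close>. The inhomogeneous equation thereby becomes the homogeneous
  mode equation with \<open>z = - 1\<close>.\<close>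

lemma augmented_solution_deriv:
  assumes u: "(u has_vector_derivative (A *v u t + b)) (at t within S)" and s: "s \<noteq> 0"
  shows "((\<lambda>t. stack_vec (u t) (of_real s *s r0)) has_vector_derivative
    (H1gam (1 / s) A b *v stack_vec (u t) (of_real s *s r0)
      + \<i> *s (H2gam (1 / s) A b *v stack_vec (u t) (of_real s *s r0)))) (at t within S)"
proof -
  have lin: "bounded_linear (\<lambda>x::complex^'n. stack_vec x (0 :: complex^'n))"
    unfolding linear_conv_bounded_linear[symmetric]
    by (intro linearI) (auto simp: vec_eq_iff stack_vec_def split: sum.split)
  have "((\<lambda>t. stack_vec (u t) 0 + stack_vec 0 (of_real s *s r0)) has_vector_derivative
      stack_vec (A *v u t + b) 0 + 0) (at t within S)"
    by (intro has_vector_derivative_add has_vector_derivative_const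
        bounded_linear.has_vector_derivative[OF lin u])
  moreover have "of_real (1 / s) *s (diag_mat b *v (of_real s *s r0)) = b"
    using s by (simp add: vec_eq_iff diag_mat_vec r0_def)
  ultimately show ?thesis
    by (simp only: H1gam_plus_i_H2gam stack_vec_add add_0_right add_0_left)
qed

text \<open>This passes from the Lebesgue integral over the open recovery interval to the gauge
  integral over its closure, where the energy estimate lives.\<close>

lemma L2_norm_on_le:
  fixes f :: "real \<Rightarrow> complex^'n"
  assumes "continuous_on {a..b} f" "continuous_on {a..b} g" "a \<le> b"
    "\<And>p. p \<in> {a..b} \<Longrightarrow> norm (f p) \<le> c * norm (g p)" "0 \<le> c"
  shows "L2_norm_on {a<..<b} f \<le> c * sqrt (integral {a..b} (\<lambda>p. (norm (g p))\<^sup>2))"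
proof -
  have "set_integrable lborel {a..b} (\<lambda>p. (norm (f p))\<^sup>2)"
    by (intro borel_integrable_atLeastAtMost' continuous_intros assms)
  then have "set_integrable lborel {a<..<b} (\<lambda>p. (norm (f p))\<^sup>2)"
    by (rule set_integrable_subset) auto
  then have "(LINT p:{a<..<b}|lborel. (norm (f p))\<^sup>2) = integral {a<..<b} (\<lambda>p. (norm (f p))\<^sup>2)"
    by (rule set_borel_integral_eq_integral)
  also have "\<dots> = integral {a..b} (\<lambda>p. (norm (f p))\<^sup>2)"
    by (simp add: integral_open_interval_real)
  also have "\<dots> \<le> integral {a..b} (\<lambda>p. c\<^sup>2 * (norm (g p))\<^sup>2)"
  proof (rule integral_le)
    show "(norm (f p))\<^sup>2 \<le> c\<^sup>2 * (norm (g p))\<^sup>2" if "p \<in> {a..b}" for p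
      using power_mono[OF assms(4)[OF that] norm_ge_zero, of 2] by (simp add: power_mult_distrib)
  qed (intro integrable_continuous_real continuous_intros assms)+
  finally have "(LINT p:{a<..<b}|lborel. (norm (f p))\<^sup>2) \<le> c\<^sup>2 * integral {a..b} (\<lambda>p. (norm (g p))\<^sup>2)"
    by simp
  then have "L2_norm_on {a<..<b} f \<le> sqrt (c\<^sup>2 * integral {a..b} (\<lambda>p. (norm (g p))\<^sup>2))"
    unfolding L2_norm_on_def by (rule real_sqrt_le_mono)
  then show ?thesis using assms(5) by (simp add: real_sqrt_mult)
qed

text \<open>The recovery interval is traced back to
  \<open>[p - \<Lambda> T, p + R + \<mu> T]\<close> at time 0. The threshold condition on
  \<open>p\<close> keeps that interval in the half-line of nonnegative arguments, where the scalar
  quadrature bound holds, and its length is at most \<open>p + R + \<mu> T\<close>.\<close>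

lemma recovery_error_bound:
  fixes A :: "real \<Rightarrow> complex^'n^'n" and b u :: "real \<Rightarrow> complex^'n"
  assumes T: "0 < T" and cA: "continuous_on {0..T} A" and cb: "continuous_on {0..T} b"
    and u: "solves_linear_ode T A b u0 u" and s: "0 < s"
    and lower: "\<And>t v. t \<in> {0<..<T} \<Longrightarrow>
      - (\<mu> * inner v v) \<le> inner v (H1gam (1 / s) (A t) (b t) *v v)"
    and mu: "0 \<le> \<mu>"
    and p: "lambda_max_plus T (\<lambda>t. H1gam (1 / s) (A t) (b t)) * T \<le> p"
    and R: "0 \<le> R" and X: "0 < X" and N: "0 < N"
    and w: "solves_fourier_system T X N (\<lambda>t. H1gam (1 / s) (A t) (b t)) (\<lambda>t. H2gam (1 / s) (A t) (b t))
      (stack_vec u0 (of_real s *s r0)) w"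
  shows "L2_norm_on {p<..<p + R} (\<lambda>q. recovered_solution X N (w T) q - u T)
    \<le> exp (p + R) * (sqrt (p + R + \<mu> * T) * ((34 / X + (p + R + \<mu> * T + 1) * mesh X N)
        * norm (stack_vec u0 (of_real s *s r0 :: complex^'n))))"
proof -
  define H1 H2 where "H1 = (\<lambda>t. H1gam (1 / s) (A t) (b t))" and "H2 = (\<lambda>t. H2gam (1 / s) (A t) (b t))"
  define \<Lambda> where "\<Lambda> = lambda_max_plus T H1"
  define w0 where "w0 = stack_vec u0 (of_real s *s r0 :: complex^'n)"
  define v where "v = (\<lambda>t. stack_vec (u t) (of_real s *s r0 :: complex^'n))"
  \<comment> \<open>The index \<open>Suc N\<close> carries minus the exact solution, the mode \<open>e\<^sup>-\<^sup>p\<close> of the transport equation.\<close>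
  define y where "y = (\<lambda>k. if k \<le> N then (\<lambda>t. w t k) else v)"
  define z :: "nat \<Rightarrow> complex" where "z = (\<lambda>k. if k \<le> N then - \<i> * of_real (node X N k) else - 1)"
  define \<alpha> where "\<alpha> = (\<lambda>j. if j = 0 \<or> j = N then mesh X N / 2 else mesh X N)"
  define c :: "nat \<Rightarrow> complex" where "c = (\<lambda>k. if k \<le> N then of_real (\<alpha> k) else - 1)"
  define e where "e = (\<lambda>t q. \<Sum>k\<in>{..Suc N}. (c k * exp (z k * of_real q)) *s y k t)"
  define a where "a = p - \<Lambda> * T"
  define d where "d = p + R + \<mu> * T"

  have cont: "continuous_on {0..T} H1" "continuous_on {0..T} H2"
    unfolding H1_def H2_def by (intro continuous_on_H1gam continuous_on_H2gam continuous_intros cA cb)+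
  have herm: "cadjoint (H1 t) = H1 t" "cadjoint (H2 t) = H2 t" for t
    by (simp_all add: H1_def H2_def cadjoint_H1gam cadjoint_H2gam)
  have \<Lambda>: "inner x (H1 t *v x) \<le> \<Lambda> * inner x x" if "t \<in> {0<..<T}" for t x
    unfolding \<Lambda>_def using that by (intro rayleigh_le_lambda_max_plus cont herm) auto
  have \<Lambda>0: "0 \<le> \<Lambda>"
    unfolding \<Lambda>_def using T by (intro rayleigh_le_lambda_max_plus(2)[of T H1 "T / 2"] cont herm) auto
  have a: "0 \<le> a" using p by (simp add: a_def \<Lambda>_def H1_def)
  have ad: "a + \<Lambda> * T = p" "d - \<mu> * T = p + R" by (simp_all add: a_def d_def)
  have ad_le: "a \<le> d" using ad \<Lambda>0 mu T R
    by (metis add_increasing2 add_le_cancel_right diff_add_cancel linear mult_nonneg_nonneg order.strict_implies_order order_trans)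

  have e_eq: "e t q = trapezoid_reconstruction X N (w t) q - of_real (exp (- q)) *s v t" for t q
  proof -
    have "e t q = (\<Sum>k\<le>N. (c k * exp (z k * of_real q)) *s y k t)
        + (c (Suc N) * exp (z (Suc N) * of_real q)) *s y (Suc N) t"
      by (simp add: e_def)
    also have "(\<Sum>k\<le>N. (c k * exp (z k * of_real q)) *s y k t) = trapezoid_reconstruction X N (w t) q"
      unfolding trapezoid_reconstruction_eq_sum[OF N]
      by (intro sum.cong refl) (simp add: c_def z_def y_def \<alpha>_def mult.assoc)
    also have "(c (Suc N) * exp (z (Suc N) * of_real q)) *s y (Suc N) t = - (of_real (exp (- q)) *s v t)"
      by (simp add: c_def z_def y_def exp_of_real[symmetric] vector_smult_lneg)
    finally show ?thesis by simp
  qed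

  have ode: "(y k has_vector_derivative (- z k *s (H1 t *v y k t) + \<i> *s (H2 t *v y k t)))
      (at t within {0..T})" if "k \<in> {..Suc N}" "t \<in> {0..T}" for k t
  proof (cases "k \<le> N")
    case True
    have "((\<lambda>s. w s k) has_vector_derivative block_apply N
        (\<lambda>k l. cscale \<i> (kron_mat (D_xi X N) (H1 t) k l + kron_mat Id_xi (H2 t) k l)) (w t) k)
        (at t within {0..T})"
      using w True that(2) unfolding solves_fourier_system_def H1_def H2_def by blast
    then show ?thesis using True by (simp add: block_apply_fourier y_def z_def)
  next
    case False
    have "(u has_vector_derivative (A t *v u t + b t)) (at t within {0..T})"
      using u that(2) by (simp add: solves_linear_ode_def)
    from augmented_solution_deriv[OF this, of s] show ?thesis
      using False s by (simp add: y_def z_def v_def H1_def H2_def)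
  qed

  have "integral {a + \<Lambda> * T..d - \<mu> * T} (\<lambda>q. (norm (e T q))\<^sup>2) \<le> integral {a..d} (\<lambda>q. (norm (e 0 q))\<^sup>2)"
    unfolding e_def
  proof (rule energy_estimate[where ?H1.0 = H1 and ?H2.0 = H2])
    show "- (\<mu> * inner x x) \<le> inner x (H1 t *v x)" if "t \<in> {0<..<T}" for t x
      unfolding H1_def by (rule lower[OF that])
  qed (use T cont herm ode \<Lambda> \<Lambda>0 mu ad R in auto)
  then have energy: "integral {p..p + R} (\<lambda>q. (norm (e T q))\<^sup>2) \<le> integral {a..d} (\<lambda>q. (norm (e 0 q))\<^sup>2)"
    by (simp only: ad)

  define Z where "Z = (34 / X + (d + 1) * mesh X N) * norm w0"
  have mesh: "0 \<le> mesh X N" using X by (simp add: mesh_def)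
  have init: "norm (e 0 q) \<le> Z" if q: "q \<in> {a..d}" for q
  proof -
    have q0: "0 \<le> q" using q a by simp
    have w_init: "w 0 j = xi_vec X N j *s w0" if "j \<le> N" for j
      using w that by (simp add: solves_fourier_system_def kron_vec_def w0_def)
    have v_init: "v 0 = w0" using u by (simp add: v_def w0_def solves_linear_ode_def)
    \<comment> \<open>All initial blocks are scalar multiples of the one vector \<open>w0\<close>,
      so the initial error is a scalar quadrature error times \<open>w0\<close>.\<close>
    have "trapezoid_reconstruction X N (w 0) q = (\<Sum>j\<le>N. \<alpha> j *\<^sub>R resolvent_mode q (node X N j)) *s w0"
      unfolding trapezoid_reconstruction_eq_sum[OF N]
        bounded_bilinear.sum_left[OF bounded_bilinear_scale_complex]
      by (intro sum.cong refl)
        (simp add: w_init \<alpha>_def xi_vec_def resolvent_mode_def scaleR_conv_of_real[where 'a = complex])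
    then have "e 0 q = ((\<Sum>j\<le>N. \<alpha> j *\<^sub>R resolvent_mode q (node X N j)) - of_real (exp (- q))) *s w0"
      by (simp add: e_eq v_init vector_sub_rdistrib)
    then have "norm (e 0 q)
        = norm ((\<Sum>j\<le>N. \<alpha> j *\<^sub>R resolvent_mode q (node X N j)) - of_real (exp (- q))) * norm w0"
      by (simp only: norm_scale_complex)
    moreover have "norm ((\<Sum>j\<le>N. \<alpha> j *\<^sub>R resolvent_mode q (node X N j)) - of_real (exp (- q)))
        \<le> (q + 1) * mesh X N + 34 / X"
      unfolding \<alpha>_def
      by (rule norm_diff_triangle_le[OF trapezoid_resolvent_error[OF q0 X N]])
        (use truncated_resolvent_integral[OF q0 X] in \<open>simp add: exp_of_real[symmetric]\<close>)
    moreover have "(q + 1) * mesh X N \<le> (d + 1) * mesh X N"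
      using q mesh by (intro mult_right_mono) auto
    ultimately show ?thesis
      unfolding Z_def by (auto intro!: mult_right_mono)
  qed
  have cont_e: "continuous_on S (e t)" for S t
    unfolding e_def by (intro continuous_intros continuous_on_scale_complex)
  have "integral {a..d} (\<lambda>q. (norm (e 0 q))\<^sup>2) \<le> integral {a..d} (\<lambda>q. Z\<^sup>2)"
    by (rule integral_le)
      (auto intro!: integrable_continuous_real continuous_intros cont_e power_mono init)
  also have "\<dots> \<le> d * Z\<^sup>2" using ad_le a by (simp add: mult_right_mono)
  finally have "sqrt (integral {p..p + R} (\<lambda>q. (norm (e T q))\<^sup>2)) \<le> sqrt (d * Z\<^sup>2)"
    using energy by (intro real_sqrt_le_mono) simp
  also have "0 \<le> Z" unfolding Z_def using X mesh ad_le a by simp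
  then have "sqrt (d * Z\<^sup>2) = sqrt d * Z" by (simp add: real_sqrt_mult)
  finally have sqrt_le: "sqrt (integral {p..p + R} (\<lambda>q. (norm (e T q))\<^sup>2)) \<le> sqrt d * Z" .

  \<comment> \<open>The factor \<open>exp q\<close> cancels the decay of the exact mode, so its
    first block contributes exactly \<open>u T\<close>.\<close>
  have rec: "recovered_solution X N (w T) q - u T = exp q *\<^sub>R first_block (e T q)" for q
  proof -
    have "first_block (e T q) = first_block (trapezoid_reconstruction X N (w T) q) - exp (- q) *\<^sub>R u T"
      by (simp add: linear_diff[OF bounded_linear.linear[OF bounded_linear_first_block]]
          linear_scale[OF bounded_linear.linear[OF bounded_linear_first_block]] e_eq v_def first_block_stack_vec flip: scaleR_eq_scale_complex)
    then show ?thesis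
      by (simp add: recovered_solution_def scaleR_diff_right exp_minus)
  qed
  have "L2_norm_on {p<..<p + R} (\<lambda>q. recovered_solution X N (w T) q - u T)
      \<le> exp (p + R) * sqrt (integral {p..p + R} (\<lambda>q. (norm (e T q))\<^sup>2))"
    unfolding rec
  proof (rule L2_norm_on_le)
    show "continuous_on {p..p + R} (\<lambda>q. exp q *\<^sub>R first_block (e T q))"
      by (intro continuous_intros bounded_linear.continuous_on[OF bounded_linear_first_block] cont_e)
    show "norm (exp q *\<^sub>R first_block (e T q)) \<le> exp (p + R) * norm (e T q)" if "q \<in> {p..p + R}" for q
      using that by (auto intro!: mult_mono norm_first_block_le)
  qed (use R cont_e in auto)
  also have "\<dots> \<le> exp (p + R) * (sqrt d * Z)"
    by (rule mult_left_mono[OF sqrt_le]) simp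
  finally show ?thesis by (simp only: d_def Z_def w0_def)
qed

section \<open>Constants uniform in the parameters\<close>

lemma linf_norm_ge: "cmod (v $ i) \<le> linf_norm v"
  unfolding linf_norm_def by (rule Max_ge) auto

lemma linf_norm_le_norm: "linf_norm v \<le> norm v"
  unfolding linf_norm_def by (subst Max_le_iff) (auto intro: Finite_Cartesian_Product.norm_nth_le)

text \<open>A nonzero entry of \<open>b t\<close> bounds the supremum from below, and continuity
  makes the supremum an upper bound. Positivity ensures that \<gamma> is a true reciprocal rather
  than the default value of a division by 0.\<close>

lemma sup_norm_on_pos:
  assumes "continuous_on {0..T} b" "t \<in> {0..T}" "b t \<noteq> 0"
  shows "0 < sup_norm_on T b"
proof -
  obtain M where M: "\<And>t. t \<in> {0..T} \<Longrightarrow> norm (b t) \<le> M"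
    using compact_imp_bounded[OF compact_continuous_image[OF assms(1) compact_Icc]]
    unfolding bounded_iff by (meson imageI)
  have "bdd_above ((\<lambda>t. linf_norm (b t)) ` {0..T})"
    using M linf_norm_le_norm by (intro bdd_aboveI2[where M = M]) (blast intro: order_trans)
  then have le: "linf_norm (b t) \<le> sup_norm_on T b"
    unfolding sup_norm_on_def using assms(2) by (rule cSUP_upper2) simp
  obtain i where "b t $ i \<noteq> 0" using assms(3) by (auto simp: vec_eq_iff)
  then have "0 < cmod (b t $ i)" by simp
  also have "\<dots> \<le> linf_norm (b t)" by (rule linf_norm_ge)
  finally show ?thesis using le by simp
qed

text \<open>Joint compactness in time and coupling yields a single \<mu>. Uniformity in the coupling
  matters because the final constant is fixed before \<open>C_T\<close>, hence before
  \<gamma>.\<close>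

lemma H1gam_form_lower_bound:
  fixes A :: "real \<Rightarrow> complex^'n^'n"
  assumes "continuous_on {0..T} A" "continuous_on {0..T} b"
  obtains \<mu> where "0 \<le> \<mu>" "\<And>t g v. t \<in> {0..T} \<Longrightarrow> g \<in> {0..\<Gamma>} \<Longrightarrow>
    - (\<mu> * inner v v) \<le> inner v (H1gam g (A t) (b t) *v v)"
proof -
  have "continuous_on ({0..T} \<times> {0..\<Gamma>}) (\<lambda>x. H1gam (snd x) (A (fst x)) (b (fst x)))"
    by (intro continuous_on_H1gam continuous_intros continuous_on_compose2[OF assms(1)]
        continuous_on_compose2[OF assms(2)]) auto
  from compact_imp_bounded[OF compact_continuous_image[OF this]]
  obtain M where M: "\<And>t g. t \<in> {0..T} \<Longrightarrow> g \<in> {0..\<Gamma>} \<Longrightarrow> norm (H1gam g (A t) (b t)) \<le> M"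
    unfolding bounded_iff by (force simp: compact_Times)
  obtain k where k: "k > 0" "\<And>(P::complex^('n+'n)^('n+'n)) v. norm (P *v v) \<le> norm P * norm v * k"
    using bounded_bilinear.pos_bounded[OF bounded_bilinear_matrix_vector_complex] by blast
  show ?thesis
  proof (rule that[of "\<bar>M\<bar> * k"])
    show "- ((\<bar>M\<bar> * k) * inner v v) \<le> inner v (H1gam g (A t) (b t) *v v)"
      if "t \<in> {0..T}" "g \<in> {0..\<Gamma>}" for t g v
    proof -
      have "norm (H1gam g (A t) (b t) *v v) \<le> norm (H1gam g (A t) (b t)) * norm v * k" by (rule k)
      also have "\<dots> \<le> \<bar>M\<bar> * norm v * k"
        using M[OF that] k(1) by (intro mult_right_mono) auto
      finally have "norm v * norm (H1gam g (A t) (b t) *v v) \<le> norm v * (\<bar>M\<bar> * norm v * k)"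
        by (rule mult_left_mono) simp
      then have "\<bar>inner v (H1gam g (A t) (b t) *v v)\<bar> \<le> (\<bar>M\<bar> * k) * inner v v"
        using Cauchy_Schwarz_ineq2[of v "H1gam g (A t) (b t) *v v"]
        by (simp add: dot_square_norm power2_eq_square mult_ac)
      then show ?thesis by simp
    qed
  qed (use k(1) in simp)
qed

text \<open>Expand the square of \<open>\<epsilon> - h * sqrt F\<close> and divide by
  \<open>2 * \<epsilon> * sqrt F\<close>. This trades the first-order quadrature error for the
  second-order term with weight \<open>1 / \<epsilon>\<close>.\<close>

lemma mesh_le_am_gm:
  assumes "0 < \<epsilon>" "0 < F" "0 \<le> (h::real)"
  shows "h \<le> 1 / (2 * sqrt F) * (\<epsilon> + 1 / \<epsilon> * h\<^sup>2 * F)"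
proof -
  have F: "F = (sqrt F)\<^sup>2" "0 < sqrt F" using assms by auto
  have "0 \<le> (\<epsilon> - h * sqrt F)\<^sup>2" by simp
  then have "2 * (\<epsilon> * (h * sqrt F)) \<le> \<epsilon>\<^sup>2 + h\<^sup>2 * (sqrt F)\<^sup>2"
    by (simp add: power2_diff power_mult_distrib algebra_simps)
  then have "2 * (\<epsilon> * (h * sqrt F)) / \<epsilon> \<le> (\<epsilon>\<^sup>2 + h\<^sup>2 * F) / \<epsilon>"
    using assms by (intro divide_right_mono) auto
  then have "h * (2 * sqrt F) \<le> \<epsilon> + 1 / \<epsilon> * h\<^sup>2 * F"
    using assms by (simp add: add_divide_distrib power2_eq_square mult_ac)
  then show ?thesis using F(2) by (simp add: field_simps)
qed

text \<open>\<open>K\<close> is one bound for all implied constants of the O-notation, and the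
  function \<open>C\<close> is chosen before \<open>C_T\<close>, \<gamma>, \<epsilon> and
  \<open>N\<close>. If the coefficient of the mesh term vanishes, the bound retains only \<epsilon>,
  and the constant may then depend on \<open>X\<close>; otherwise it is a single number.\<close>

theorem corollary5p5:
  fixes T K :: real
    and A :: "real \<Rightarrow> complex^'n^'n"
    and b u :: "real \<Rightarrow> complex^'n"
    and u0 :: "complex^'n"
  assumes "T > 0"
    and "continuous_on {0..T} A"
    and "continuous_on {0..T} b"
    and "\<exists>t\<in>{0..T}. b t \<noteq> 0"
    and "solves_linear_ode T A b u0 u"
  shows "\<exists>C :: real \<Rightarrow> real.
    (\<forall>X. C X > 0) \<and>
    ((lambda_max_plus T (\<lambda>t. H1A (A t)) * T)\<^sup>2
        + (spectral_norm (integral {0..T} (\<lambda>s. H1A (A s))))\<^sup>2 \<noteq> 0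
      \<longrightarrow> (\<forall>X Y. C X = C Y)) \<and>
    (\<forall>(C_T::real) (\<gamma>::real) (p_dia::real) (p_gam::real) (R::real) (\<epsilon>::real) (X::real) (N::nat) w.
      T \<le> C_T \<longrightarrow> C_T \<le> K \<longrightarrow>
      \<gamma> = 1 / (C_T * sup_norm_on T b) \<longrightarrow>
      p_dia = lambda_max_plus T (\<lambda>t. H1A (A t)) * T \<longrightarrow>
      lambda_max_plus T (\<lambda>t. H1gam \<gamma> (A t) (b t)) * T \<le> p_gam \<longrightarrow>
      \<bar>p_gam - p_dia\<bar> \<le> K * (\<gamma> * sup_norm_on T b * T) \<longrightarrow>
      1 \<le> R \<longrightarrow> exp R \<le> K \<longrightarrow>
      0 < \<epsilon> \<longrightarrow> 0 < X \<longrightarrow> inverse X \<le> K * \<epsilon> \<longrightarrow>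
      0 < N \<longrightarrow>
      solves_fourier_system T X N
        (\<lambda>t. H1gam \<gamma> (A t) (b t)) (\<lambda>t. H2gam \<gamma> (A t) (b t))
        (stack_vec u0 (of_real (C_T * sup_norm_on T b) *s r0)) w \<longrightarrow>
      L2_norm_on {p_gam<..<p_gam + R} (\<lambda>p. recovered_solution X N (w T) p - u T)
        \<le> C X * (\<epsilon> + 1 / \<epsilon> * (mesh X N)\<^sup>2 *
               (p_dia\<^sup>2 + (spectral_norm (integral {0..T} (\<lambda>s. H1A (A s))))\<^sup>2))
          * exp p_dia
          * (norm u0 + C_T * sup_norm_on T b * norm (r0 :: complex^'n)))"
proof -
  define \<beta> where "\<beta> = sup_norm_on T b"
  have \<beta>: "0 < \<beta>" using assms(4) sup_norm_on_pos[OF assms(3)] by (auto simp: \<beta>_def)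
  \<comment> \<open>Since \<open>T \<le> C_T\<close>, every admissible \<gamma> is at most
    \<open>1 / (T * \<beta>)\<close>, so this \<mu> serves all of them.\<close>
  obtain \<mu> where \<mu>: "0 \<le> \<mu>" "\<And>t g v. t \<in> {0..T} \<Longrightarrow> g \<in> {0..1 / (T * \<beta>)} \<Longrightarrow>
    - (\<mu> * inner v v) \<le> inner v (H1gam g (A t) (b t) *v v)"
    using H1gam_form_lower_bound[OF assms(2,3)] by blast
  define pd where "pd = lambda_max_plus T (\<lambda>t. H1A (A t)) * T"
  define F where "F = pd\<^sup>2 + (spectral_norm (integral {0..T} (\<lambda>s. H1A (A s))))\<^sup>2"
  have F: "0 \<le> F" by (simp add: F_def)
  \<comment> \<open>\<open>B\<close> dominates \<open>p + R + \<mu> * T\<close>: the threshold is at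
    most \<open>pd + K\<close> because \<open>\<gamma> * \<beta> * T = T / C_T \<le> 1\<close>, and
    \<open>R \<le> K\<close> follows from \<open>exp R \<le> K\<close>.\<close>
  define B where "B = \<bar>pd\<bar> + 2 * \<bar>K\<bar> + \<mu> * T"
  \<comment> \<open>If \<open>F = 0\<close> the mesh term is absent from the bound, and only \<open>h \<le> 2 X \<le> 2 K X\<^sup>2 \<epsilon>\<close> is left.\<close>
  define m where "m = (\<lambda>X. if F = 0 then 2 * \<bar>K\<bar> * X\<^sup>2 else 1 / (2 * sqrt F))"
  \<comment> \<open>\<open>exp (2 * K)\<close> is what remains of \<open>exp (p + R)\<close> once
    \<open>exp pd\<close> is split off. In \<open>C\<close>, the term with 34 pays for the
    truncation through \<open>1 / X \<le> K * \<epsilon>\<close>, the term with \<open>m X\<close>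
    pays for the quadrature, and the final 1 makes \<open>C\<close> positive.\<close>
  define Q where "Q = exp (2 * K) * sqrt B"
  define C where "C = (\<lambda>X. Q * (34 * \<bar>K\<bar> + (B + 1) * m X) + 1)"
  have B: "0 \<le> B" using \<mu>(1) assms(1) by (simp add: B_def)
  have m: "0 \<le> m X" for X using F by (simp add: m_def)
  have Q: "0 \<le> Q" using B by (simp add: Q_def)
  have Cpos: "0 < C X" for X
    using Q B m[of X] unfolding C_def by (intro add_nonneg_pos mult_nonneg_nonneg add_nonneg_nonneg) auto
  have main: "L2_norm_on {p<..<p + R} (\<lambda>p. recovered_solution X N (w T) p - u T)
        \<le> C X * (\<epsilon> + 1 / \<epsilon> * (mesh X N)\<^sup>2 * F) * exp pd
          * (norm u0 + C_T * \<beta> * norm (r0 :: complex^'n))"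
    if C_T: "T \<le> C_T" "C_T \<le> K"
      and p: "lambda_max_plus T (\<lambda>t. H1gam (1 / (C_T * \<beta>)) (A t) (b t)) * T \<le> p"
        "\<bar>p - pd\<bar> \<le> K * (1 / (C_T * \<beta>) * \<beta> * T)"
      and R: "1 \<le> R" "exp R \<le> K" and \<epsilon>: "0 < \<epsilon>" and X: "0 < X" "inverse X \<le> K * \<epsilon>" and N: "0 < N"
      and w: "solves_fourier_system T X N
        (\<lambda>t. H1gam (1 / (C_T * \<beta>)) (A t) (b t)) (\<lambda>t. H2gam (1 / (C_T * \<beta>)) (A t) (b t))
        (stack_vec u0 (of_real (C_T * \<beta>) *s r0)) w"
    for C_T p R \<epsilon> X N w
  proof -
    define h where "h = mesh X N"
    define D where "D = \<epsilon> + 1 / \<epsilon> * h\<^sup>2 * F"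
    have CT0: "0 < C_T" using C_T assms(1) by simp
    have s: "0 < C_T * \<beta>" using CT0 \<beta> by simp
    have K0: "0 < K" using C_T CT0 by simp
    have RK: "R \<le> K" using exp_ge_add_one_self[of R] R by linarith
    have "T / C_T \<le> 1" using C_T CT0 by simp
    then have "K * (1 / (C_T * \<beta>) * \<beta> * T) \<le> K"
      using K0 \<beta> mult_left_mono[of "T / C_T" 1 K] by simp
    then have ppd: "p \<le> pd + K" using p(2) by linarith
    have pR: "p + R \<le> pd + 2 * K" using ppd RK by simp
    have dB: "p + R + \<mu> * T \<le> B" using pR K0 by (simp add: B_def)
    have "0 \<le> lambda_max_plus T (\<lambda>t. H1gam (1 / (C_T * \<beta>)) (A t) (b t))"
      using assms(1) by (intro rayleigh_le_lambda_max_plus(2)[of T _ "T / 2"] continuous_on_H1gam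
          continuous_on_const assms(2,3) cadjoint_H1gam) auto
    then have "0 \<le> lambda_max_plus T (\<lambda>t. H1gam (1 / (C_T * \<beta>)) (A t) (b t)) * T"
      using assms(1) by simp
    then have "0 \<le> p" using p(1) by (rule order_trans)
    then have d0: "0 \<le> p + R + \<mu> * T" using \<mu>(1) assms(1) R(1) by simp
    have h0: "0 \<le> h" using X by (simp add: h_def mesh_def)
    have D\<epsilon>: "\<epsilon> \<le> D" using \<epsilon> F by (simp add: D_def)
    have gam: "1 / (C_T * \<beta>) \<in> {0..1 / (T * \<beta>)}"
      using C_T assms(1) \<beta> by (auto intro!: divide_left_mono mult_right_mono)
    have mesh_bound: "h \<le> m X * D"
    proof (cases "F = 0")
      case True
      have "1 \<le> K * \<epsilon> * X" using X by (simp add: field_simps)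
      then have "2 * X * 1 \<le> 2 * X * (K * \<epsilon> * X)" using X by (intro mult_left_mono) auto
      moreover have "h \<le> 2 * X"
        using X N by (simp add: h_def mesh_def divide_le_eq)
      ultimately show ?thesis
        using K0 True by (simp add: m_def D_def power2_eq_square mult_ac)
    next
      case False
      then show ?thesis
        using mesh_le_am_gm[OF \<epsilon>, of F h] F h0 by (simp add: m_def D_def)
    qed
    have X_bound: "34 / X \<le> 34 * K * D"
    proof -
      have "34 / X \<le> 34 * (K * \<epsilon>)" using X by (simp add: divide_inverse)
      also have "\<dots> \<le> 34 * (K * D)" using D\<epsilon> K0 by simp
      finally show ?thesis by simp
    qed
    define W where "W = norm (stack_vec u0 (of_real (C_T * \<beta>) *s r0 :: complex^'n))"
    have W: "W \<le> norm u0 + C_T * \<beta> * norm (r0 :: complex^'n)"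
      using norm_stack_vec_le[of u0 "of_real (C_T * \<beta>) *s r0"] s \<beta> CT0
      by (simp add: W_def norm_scale_complex norm_mult)
    have "L2_norm_on {p<..<p + R} (\<lambda>p. recovered_solution X N (w T) p - u T)
      \<le> exp (p + R) * (sqrt (p + R + \<mu> * T) * ((34 / X + (p + R + \<mu> * T + 1) * h) * W))"
      unfolding h_def W_def
      by (rule recovery_error_bound[OF assms(1-3,5) s])
        (use \<mu> gam p(1) R(1) X(1) N w in auto)
    also have "\<dots> \<le> exp (pd + 2 * K) * (sqrt B * ((34 * K * D + (B + 1) * (m X * D)) * W))"
    proof -
      have "34 / X + (p + R + \<mu> * T + 1) * h \<le> 34 * K * D + (B + 1) * (m X * D)"
        using dB B h0 mesh_bound X_bound
        d0 mult_mono[of "p + R + \<mu> * T + 1" "B + 1" h "m X * D"] by simp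
      moreover have "0 \<le> 34 / X + (p + R + \<mu> * T + 1) * h"
        using d0 X h0 by simp
      moreover have "0 \<le> W" by (simp add: W_def)
      moreover have "sqrt (p + R + \<mu> * T) \<le> sqrt B" using dB by simp
      moreover have "exp (p + R) \<le> exp (pd + 2 * K)" using pR by simp
      ultimately show ?thesis
        using B d0 by (intro mult_mono mult_nonneg_nonneg) auto
    qed
    also have "\<dots> = (Q * (34 * \<bar>K\<bar> + (B + 1) * m X)) * D * exp pd * W"
      using K0 by (simp add: Q_def exp_add algebra_simps)
    also have "\<dots> \<le> C X * D * exp pd * (norm u0 + C_T * \<beta> * norm (r0 :: complex^'n))"
      using W Cpos[of X] D\<epsilon> \<epsilon> by (intro mult_mono mult_nonneg_nonneg) (auto simp: C_def W_def)
    finally show ?thesis by (simp only: D_def h_def)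
  qed
  have "F \<noteq> 0 \<longrightarrow> (\<forall>X Y. C X = C Y)" by (simp add: C_def m_def)
  then show ?thesis
    using Cpos main unfolding F_def pd_def \<beta>_def by (intro exI[of _ C]) blast
qed

end
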